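(* Let $(\overline X,\overline Y^1,\dots,\overline Y^m)$ be the unique (pathwise) solution of the system (S) of the context with given initial data $(\overline X_0,\overline Y_0^1,\dots,\overline Y_0^m)$, and let $\overline\mu_t=\mathrm{Law}(\overline X(t))$. Then the $(m+1)$-tuple $(\overline\mu_t,\overline Y^1(t),\dots,\overline Y^m(t))$ solves the PDE–ODE system $$\begin{cases}(\partial_t-\sigma\Delta)\overline\mu_t=-\mathrm{div}\Big(\big(H_1\ast\overline\mu_t(\cdot)+\frac1m\sum_{j=1}^mK_1(\overline Y^j(t)-\cdot)\big)\overline\mu_t\Big)\\ \frac{d}{dt}\overline Y^i(t)=K_2\ast\overline\mu_t(\overline Y^i(t))+\frac1m\sum_{j=1}^mH_2(\overline Y^j(t)-\overline Y^i(t))+u^i(t,\overline\mu_t),\quad i=1,\dots,m\\ \overline\mu_0=\mathrm{Law}(\overline X_0),\ \overline Y^i(0)=\overline Y^i_0,\quad i=1,\dots,m.\end{cases}$$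
   Context: Fix $d,m\in\mathbb N$, $T>0$, $\sigma>0$, a filtered probability space $(\Omega,\mathcal F,(\mathcal F_t),\mathbb P)$ and a $d$-dimensional $(\mathcal F_t)$-Brownian motion $W$. $\mathcal W_1(\mathbb R^d)$ is the space of Borel probability measures on $\mathbb R^d$ with finite first moment, with the 1-Wasserstein distance. $\mathrm{Law}(X)=X_\sharp\mathbb P$ and $\mathrm{ev}_t(f)=f(t)$. For a Lipschitz $H$ and $\mu\in\mathcal W_1(\mathbb R^d)$, $H\ast\mu(x)=\int_{\mathbb R^d}H(x-y)\,d\mu(y)$. $H_1,H_2,K_1,K_2:\mathbb R^d\to\mathbb R^d$ are globally Lipschitz. The controls $u^i:[0,T]\times\mathcal W_1(\mathbb R^d)\to\mathbb R^d$ are Carathéodory functions (measurable in $t$, continuous in $\mu$, with $u^i(\cdot,\mu)\in L^1(0,T)$ for each $\mu$), and $u^i(t,\cdot)$ is Lipschitz for each $t$ with a Lipschitz constant that is integrable on $[0,T]$. The initial data satisfy: $\overline X_0\in L^p(\Omega;\mathbb R^d)$ for some $p>1$, $\mathcal F_0$-measurable, and $\overline Y^i_0\in\mathbb R^d$. System (S): $$\begin{cases} d\overline X(t)=\Big(H_1\ast\overline\mu_t(\overline X(t))+\frac1m\sum_{j=1}^mK_1(\overline Y^j(t)-\overline X(t))\Big)dt+\sqrt{2\sigma}\,dW(t)\\ \frac{d}{dt}\overline Y^i(t)=K_2\ast\overline\mu_t(\overline Y^i(t))+\frac1m\sum_{j=1}^mH_2(\overline Y^j(t)-\overline Y^i(t))+u^i(t,\overline\mu_t),\quad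 i=1,\dots,m\\ \overline X(0)=\overline X_0,\ \overline Y^i(0)=\overline Y^i_0,\quad i=1,\dots,m\\ \overline\mu=\mathrm{Law}(\overline X),\ \overline\mu_t=(\mathrm{ev}_t)_\sharp\overline\mu.\end{cases}$$ A pathwise solution consists of a $C^0([0,T];\mathbb R^d)$-valued random variable $\overline X$ satisfying the first equation in integral form almost surely for all $t$, and deterministic $\overline Y^i\in C^0([0,T];\mathbb R^d)$ that are Carathéodory solutions of the ODEs. Such a solution exists and is pathwise unique. The PDE is understood in the weak sense: for every $\varphi\in C_c^\infty(\mathbb R^d)$ and $t\in[0,T]$, $$\int\varphi\,d\overline\mu_t=\int\varphi\,d\overline\mu_0+\int_0^t\int\Big[\Big\langle\nabla\varphi(x),H_1\ast\overline\mu_s(x)+\frac1m\sum_{j=1}^mK_1(\overline Y^j(s)-x)\Big\rangle+\sigma\Delta\varphi(x)\Big]d\overline\mu_s(x)\,ds;$$ the ODEs are understood in the Carathéodory sense. *)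

theory Defs
  imports "HOL-Probability.Probability"
begin

section \<open>Probability measures with finite first moment\<close>

definition W1_space :: "('v::euclidean_space) measure set" where
  "W1_space = {\<mu>. prob_space \<mu> \<and> sets \<mu> = sets borel \<and> integrable \<mu> norm}"

definition couplings ::
  "('v::euclidean_space) measure \<Rightarrow> 'v measure \<Rightarrow> ('v \<times> 'v) measure set" where
  "couplings \<mu> \<nu> = {\<pi>. prob_space \<pi> \<and> sets \<pi> = sets borel \<and>
     distr \<pi> borel fst = \<mu> \<and> distr \<pi> borel snd = \<nu>}"

definition W1_dist :: "('v::euclidean_space) measure \<Rightarrow> 'v measure \<Rightarrow> real" where
  "W1_dist \<mu> \<nu> = (INF \<pi> \<in> couplings \<mu> \<nu>. \<integral>(x, y). dist x y \<partial>\<pi>)"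

definition mconv ::
  "('v::euclidean_space \<Rightarrow> 'v) \<Rightarrow> 'v measure \<Rightarrow> 'v \<Rightarrow> 'v" where
  "mconv H \<mu> x = (\<integral>y. H (x - y) \<partial>\<mu>)"


section \<open>Filtrations and Brownian motion\<close>

locale filtered_prob_space = prob_space M for M :: "'a measure" +
  fixes F :: "real \<Rightarrow> 'a measure" and T :: real
  assumes filtration_subalgebra: "t \<in> {0..T} \<Longrightarrow> subalgebra M (F t)"
    and filtration_mono: "0 \<le> s \<Longrightarrow> s \<le> t \<Longrightarrow> t \<le> T \<Longrightarrow> subalgebra (F t) (F s)"

text \<open>
  The density of an increment is that of the centred normal law on \<open>\<real>\<^sup>d\<close> with covariance
  \<open>(t - s) I\<close>. Path continuity and \<open>W 0 = 0\<close> are only required almost surely.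
\<close>

locale brownian_motion = filtered_prob_space M F T
  for M :: "'a measure" and F :: "real \<Rightarrow> 'a measure" and T :: real +
  fixes W :: "real \<Rightarrow> 'a \<Rightarrow> real ^ 'd"
  assumes BM_adapted: "t \<in> {0..T} \<Longrightarrow> W t \<in> borel_measurable (F t)"
    and BM_zero: "AE \<omega> in M. W 0 \<omega> = 0"
    and BM_continuous: "AE \<omega> in M. continuous_on {0..T} (\<lambda>t. W t \<omega>)"
    and BM_independent: "0 \<le> s \<Longrightarrow> s < t \<Longrightarrow> t \<le> T \<Longrightarrow>
      indep_set (sets (F s)) {(\<lambda>\<omega>. W t \<omega> - W s \<omega>) -` A \<inter> space M |A. A \<in> sets borel}"
    and BM_gaussian: "0 \<le> s \<Longrightarrow> s < t \<Longrightarrow> t \<le> T \<Longrightarrow>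
      distributed M lborel (\<lambda>\<omega>. W t \<omega> - W s \<omega>)
        (\<lambda>x. ennreal (\<Prod>i\<in>UNIV. normal_density 0 (sqrt (t - s)) (x $ i)))"


section \<open>The path space\<close>

definition path_metric :: "real \<Rightarrow> (real \<Rightarrow> real ^ 'd) metric" where
  "path_metric T = cfunspace (top_of_set {0..T}) euclidean_metric"

text \<open>
  The Borel \<open>\<sigma>\<close>-algebra of \<open>C\<^sup>0([0,T]; \<real>\<^sup>d)\<close> with the uniform distance. As usual for
  \<^const>\<open>cfunspace\<close>, paths are functions that equal \<^const>\<open>undefined\<close> outside \<open>[0,T]\<close>.
\<close>

definition path_space :: "real \<Rightarrow> (real \<Rightarrow> real ^ 'd) measure" where
  "path_space T = sigma (mspace (path_metric T)) {U. openin (mtopology_of (path_metric T)) U}"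

definition path_law ::
  "'a measure \<Rightarrow> real \<Rightarrow> ('a \<Rightarrow> real \<Rightarrow> real ^ 'd) \<Rightarrow> (real \<Rightarrow> real ^ 'd) measure" where
  "path_law M T X = distr M (path_space T) X"

definition ev_law :: "(real \<Rightarrow> real ^ 'd) measure \<Rightarrow> real \<Rightarrow> (real ^ 'd) measure" where
  "ev_law \<mu> t = distr \<mu> borel (\<lambda>f. f t)"


section \<open>Data\<close>

text \<open>
  Measurability and integrability in time are meant with respect to the Lebesgue
  \<open>\<sigma>\<close>-algebra. A control is only constrained on \<open>[0,T] \<times> W1_space\<close>.
\<close>

definition caratheodory_control ::
  "real \<Rightarrow> (real \<Rightarrow> (real ^ 'd) measure \<Rightarrow> real ^ 'd) \<Rightarrow> bool" where
  "caratheodory_control T u \<longleftrightarrow>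
     (\<forall>\<mu>\<in>W1_space. set_borel_measurable lebesgue {0..T} (\<lambda>t. u t \<mu>)) \<and>
     (\<forall>t\<in>{0..T}. \<forall>\<mu>\<in>W1_space. \<forall>\<epsilon>>0. \<exists>\<delta>>0. \<forall>\<nu>\<in>W1_space.
        W1_dist \<mu> \<nu> < \<delta> \<longrightarrow> dist (u t \<mu>) (u t \<nu>) < \<epsilon>) \<and>
     (\<forall>\<mu>\<in>W1_space. set_integrable lebesgue {0..T} (\<lambda>t. u t \<mu>))"

definition integrably_lipschitz_control ::
  "real \<Rightarrow> (real \<Rightarrow> (real ^ 'd) measure \<Rightarrow> real ^ 'd) \<Rightarrow> bool" where
  "integrably_lipschitz_control T u \<longleftrightarrow>
     (\<exists>L :: real \<Rightarrow> real. set_integrable lebesgue {0..T} L \<and>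
        (\<forall>t\<in>{0..T}. 0 \<le> L t \<and>
           (\<forall>\<mu>\<in>W1_space. \<forall>\<nu>\<in>W1_space. dist (u t \<mu>) (u t \<nu>) \<le> L t * W1_dist \<mu> \<nu>)))"


section \<open>The SDE--ODE system\<close>

definition X_drift ::
  "(real ^ 'd \<Rightarrow> real ^ 'd) \<Rightarrow> (real ^ 'd \<Rightarrow> real ^ 'd) \<Rightarrow>
   (real ^ 'd) measure \<Rightarrow> ('m::finite \<Rightarrow> real ^ 'd) \<Rightarrow> real ^ 'd \<Rightarrow> real ^ 'd" where
  "X_drift H1 K1 \<mu> y x =
     mconv H1 \<mu> x + (1 / real CARD('m)) *\<^sub>R (\<Sum>j\<in>UNIV. K1 (y j - x))"

definition Y_drift ::
  "(real ^ 'd \<Rightarrow> real ^ 'd) \<Rightarrow> (real ^ 'd \<Rightarrow> real ^ 'd) \<Rightarrow>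
   ('m::finite \<Rightarrow> real \<Rightarrow> (real ^ 'd) measure \<Rightarrow> real ^ 'd) \<Rightarrow>
   real \<Rightarrow> (real ^ 'd) measure \<Rightarrow> ('m \<Rightarrow> real ^ 'd) \<Rightarrow> 'm \<Rightarrow> real ^ 'd" where
  "Y_drift K2 H2 u t \<mu> y i =
     mconv K2 \<mu> (y i) + (1 / real CARD('m)) *\<^sub>R (\<Sum>j\<in>UNIV. H2 (y j - y i)) + u i t \<mu>"

definition caratheodory_solution ::
  "real \<Rightarrow> (real \<Rightarrow> ('m \<Rightarrow> real ^ 'd) \<Rightarrow> 'm \<Rightarrow> real ^ 'd) \<Rightarrow>
   ('m \<Rightarrow> real ^ 'd) \<Rightarrow> ('m \<Rightarrow> real \<Rightarrow> real ^ 'd) \<Rightarrow> bool" where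
  "caratheodory_solution T g Y0 Y \<longleftrightarrow>
     (\<forall>i. continuous_on {0..T} (Y i) \<and> Y i 0 = Y0 i \<and>
        set_integrable lebesgue {0..T} (\<lambda>s. g s (\<lambda>j. Y j s) i) \<and>
        (\<forall>t\<in>{0..T}. Y i t = Y i 0 + (LINT s:{0..t}|lebesgue. g s (\<lambda>j. Y j s) i)))"

text \<open>
  The condition that all time marginals lie in \<^const>\<open>W1_space\<close> is what makes the convolutions
  and \<open>u i t (\<mu> t)\<close> meaningful.
\<close>

definition pathwise_solution ::
  "'a measure \<Rightarrow> (real \<Rightarrow> 'a \<Rightarrow> real ^ 'd) \<Rightarrow> real \<Rightarrow> real \<Rightarrow>
   (real ^ 'd \<Rightarrow> real ^ 'd) \<Rightarrow> (real ^ 'd \<Rightarrow> real ^ 'd) \<Rightarrow>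
   (real ^ 'd \<Rightarrow> real ^ 'd) \<Rightarrow> (real ^ 'd \<Rightarrow> real ^ 'd) \<Rightarrow>
   ('m::finite \<Rightarrow> real \<Rightarrow> (real ^ 'd) measure \<Rightarrow> real ^ 'd) \<Rightarrow>
   ('a \<Rightarrow> real ^ 'd) \<Rightarrow> ('m \<Rightarrow> real ^ 'd) \<Rightarrow>
   ('a \<Rightarrow> real \<Rightarrow> real ^ 'd) \<Rightarrow> ('m \<Rightarrow> real \<Rightarrow> real ^ 'd) \<Rightarrow> bool" where
  "pathwise_solution M W T \<sigma> H1 H2 K1 K2 u X0 Y0 X Y \<longleftrightarrow>
     (let \<mu> = ev_law (path_law M T X) in
        X \<in> measurable M (path_space T) \<and>
        (\<forall>t\<in>{0..T}. \<mu> t \<in> W1_space) \<and>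
        (AE \<omega> in M. X \<omega> 0 = X0 \<omega> \<and>
           set_integrable lebesgue {0..T} (\<lambda>s. X_drift H1 K1 (\<mu> s) (\<lambda>j. Y j s) (X \<omega> s)) \<and>
           (\<forall>t\<in>{0..T}. X \<omega> t = X \<omega> 0
              + (LINT s:{0..t}|lebesgue. X_drift H1 K1 (\<mu> s) (\<lambda>j. Y j s) (X \<omega> s))
              + sqrt (2 * \<sigma>) *\<^sub>R W t \<omega>)) \<and>
        caratheodory_solution T (\<lambda>s. Y_drift K2 H2 u s (\<mu> s)) Y0 Y)"


section \<open>The PDE--ODE system\<close>

definition partial_deriv :: "'d \<Rightarrow> (real ^ 'd \<Rightarrow> real) \<Rightarrow> real ^ 'd \<Rightarrow> real" where
  "partial_deriv i f x = frechet_derivative f (at x) (axis i 1)"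

primrec C_k :: "nat \<Rightarrow> (real ^ 'd \<Rightarrow> real) \<Rightarrow> bool" where
  "C_k 0 f \<longleftrightarrow> continuous_on UNIV f"
| "C_k (Suc k) f \<longleftrightarrow> (\<forall>x. f differentiable (at x)) \<and> (\<forall>i. C_k k (partial_deriv i f))"

definition test_functions :: "(real ^ 'd \<Rightarrow> real) set" where
  "test_functions = {\<phi>. (\<forall>k. C_k k \<phi>) \<and> compact (closure {x. \<phi> x \<noteq> 0})}"

definition gradient :: "(real ^ 'd \<Rightarrow> real) \<Rightarrow> real ^ 'd \<Rightarrow> real ^ 'd" where
  "gradient f x = (\<chi> i. partial_deriv i f x)"

definition laplacian :: "(real ^ 'd \<Rightarrow> real) \<Rightarrow> real ^ 'd \<Rightarrow> real" where
  "laplacian f x = (\<Sum>i\<in>UNIV. partial_deriv i (partial_deriv i f) x)"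

text \<open>
  Weak solutions of \<open>(\<partial>\<^sub>t - \<sigma>\<Delta>) \<mu>\<^sub>t = - div (b\<^sub>t \<mu>\<^sub>t)\<close>; all integrals are
  required to exist.
\<close>

definition weak_solution ::
  "real \<Rightarrow> real \<Rightarrow> (real \<Rightarrow> real ^ 'd \<Rightarrow> real ^ 'd) \<Rightarrow> (real \<Rightarrow> (real ^ 'd) measure) \<Rightarrow> bool" where
  "weak_solution T \<sigma> b \<mu> \<longleftrightarrow>
     (\<forall>\<phi>\<in>test_functions.
        (\<forall>s\<in>{0..T}. integrable (\<mu> s) (\<lambda>x. gradient \<phi> x \<bullet> b s x + \<sigma> * laplacian \<phi> x)) \<and>
        set_integrable lebesgue {0..T}
          (\<lambda>s. \<integral>x. gradient \<phi> x \<bullet> b s x + \<sigma> * laplacian \<phi> x \<partial>\<mu> s) \<and>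
        (\<forall>t\<in>{0..T}. (\<integral>x. \<phi> x \<partial>\<mu> t) = (\<integral>x. \<phi> x \<partial>\<mu> 0) +
           (LINT s:{0..t}|lebesgue. \<integral>x. gradient \<phi> x \<bullet> b s x + \<sigma> * laplacian \<phi> x \<partial>\<mu> s)))"

definition PDE_ODE_solution ::
  "real \<Rightarrow> real \<Rightarrow>
   (real ^ 'd \<Rightarrow> real ^ 'd) \<Rightarrow> (real ^ 'd \<Rightarrow> real ^ 'd) \<Rightarrow>
   (real ^ 'd \<Rightarrow> real ^ 'd) \<Rightarrow> (real ^ 'd \<Rightarrow> real ^ 'd) \<Rightarrow>
   ('m::finite \<Rightarrow> real \<Rightarrow> (real ^ 'd) measure \<Rightarrow> real ^ 'd) \<Rightarrow>
   (real ^ 'd) measure \<Rightarrow> ('m \<Rightarrow> real ^ 'd) \<Rightarrow>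
   (real \<Rightarrow> (real ^ 'd) measure) \<Rightarrow> ('m \<Rightarrow> real \<Rightarrow> real ^ 'd) \<Rightarrow> bool" where
  "PDE_ODE_solution T \<sigma> H1 H2 K1 K2 u \<mu>0 Y0 \<mu> Y \<longleftrightarrow>
     (\<forall>t\<in>{0..T}. \<mu> t \<in> W1_space) \<and>
     \<mu> 0 = \<mu>0 \<and>
     weak_solution T \<sigma> (\<lambda>s. X_drift H1 K1 (\<mu> s) (\<lambda>j. Y j s)) \<mu> \<and>
     caratheodory_solution T (\<lambda>s. Y_drift K2 H2 u s (\<mu> s)) Y0 Y"

end

theory Submission
  imports Defs
begin

text \<open>
  Ito's formula in expectation, obtained from an Euler scheme instead of stochastic integration.
  Once the law \<open>\<mu>\<close> and the \<open>Y\<^sup>j\<close> are frozen, the drift \<open>b s x\<close> is a deterministic field, Lipschitz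
  in \<open>x\<close> and integrable in \<open>s\<close>, so the Euler scheme started at \<open>X0\<close> and driven by \<open>W\<close> converges
  pathwise to \<open>X\<close>. The scheme is adapted by construction, which replaces any measurability argument
  for \<open>X\<close>: its Brownian increments are independent of its past, and one step changes the expectation
  of a test function \<open>\<phi>\<close> by the integral of \<open>\<nabla>\<phi> \<bullet> b + \<sigma> \<Delta>\<phi>\<close> up to an error bounded uniformly in
  the state. The errors sum to \<open>o(1)\<close>, and dominated convergence along the scheme gives the weak
  equation.
\<close>

section \<open>Calculus of test functions\<close>

text \<open>Two obstacles shape the argument. An Euler step therefore integrates the drift exactly
  in time with only the state frozen, and its size is measured by the integral of
  \<open>norm (b s 0)\<close> over the cell instead of by the step length. Absolute continuity makes
  this mass uniformly small, and a sum of squared masses is at most the largest mass times the total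
  mass, which is why the accumulated error vanishes. Second, the drift grows linearly in the state.
  Paired with the gradient of a compactly supported test function it is bounded by a function of
  time alone, and this integrable majorant serves Fubini and the passage to the limit in the time
  integral. Convergence can be had path by path because the noise is additive: scheme and solution
  carry the same increments of \<open>W\<close>, which cancel in their difference and leave a
  deterministic Gronwall argument.\<close>

lemma test_functionsD:
  fixes \<phi> :: "real ^ 'd \<Rightarrow> real"
  assumes "\<phi> \<in> test_functions"
  shows "C_k k \<phi>" "compact (closure {x. \<phi> x \<noteq> 0})" "\<phi> differentiable (at x)"
proof -
  have *: "C_k k \<phi>" for k
    using assms by (auto simp: test_functions_def)
  then show "C_k k \<phi>" .
  show "compact (closure {x. \<phi> x \<noteq> 0})"
    using assms by (auto simp: test_functions_def)
  show "\<phi> differentiable (at x)"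
    using *[of "Suc 0"] by simp
qed

lemma test_function_continuous:
  fixes \<phi> :: "real ^ 'd \<Rightarrow> real"
  assumes "\<phi> \<in> test_functions"
  shows "continuous_on UNIV \<phi>"
  using test_functionsD(1)[OF assms, of 0] by simp

lemma test_function_measurable:
  fixes \<phi> :: "real ^ 'd \<Rightarrow> real"
  assumes "\<phi> \<in> test_functions"
  shows "\<phi> \<in> borel_measurable borel"
  using test_function_continuous[OF assms] by (rule borel_measurable_continuous_onI)

lemma partial_deriv_eq_0:
  assumes "open U" "x \<in> U" "\<And>y. y \<in> U \<Longrightarrow> \<phi> y = 0"
  shows "partial_deriv i \<phi> x = 0"
proof -
  have "(\<phi> has_derivative (\<lambda>_. 0)) (at x)"
    by (rule has_derivative_transform_within_open[of "\<lambda>_. 0" _ _ _ U]) (use assms in auto)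
  from frechet_derivative_at[OF this] show ?thesis
    by (simp add: partial_deriv_def fun_eq_iff)
qed

text \<open>Closure under differentiation lets each estimate below be applied again to the
  derivatives of \<open>\<phi>\<close>, where it becomes an estimate of the next order.\<close>

lemma test_functions_partial_deriv:
  fixes \<phi> :: "real ^ 'd \<Rightarrow> real"
  assumes "\<phi> \<in> test_functions"
  shows "partial_deriv i \<phi> \<in> test_functions"
proof -
  have "partial_deriv i \<phi> x = 0" if "x \<notin> closure {x. \<phi> x \<noteq> 0}" for x
    by (rule partial_deriv_eq_0[of "- closure {x. \<phi> x \<noteq> 0}"])
      (use that closure_subset[of "{x. \<phi> x \<noteq> 0}"] in auto)
  then have "{x. partial_deriv i \<phi> x \<noteq> 0} \<subseteq> closure {x. \<phi> x \<noteq> 0}" by blast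
  then have sub: "closure {x. partial_deriv i \<phi> x \<noteq> 0} \<subseteq> closure {x. \<phi> x \<noteq> 0}"
    by (simp add: closure_minimal)
  have "compact (closure {x. partial_deriv i \<phi> x \<noteq> 0})"
    using compact_Int_closed[OF test_functionsD(2)[OF assms] closed_closure, of "{x. partial_deriv i \<phi> x \<noteq> 0}"] sub
    by (simp add: inf.absorb2)
  moreover have "C_k k (partial_deriv i \<phi>)" for k
    using test_functionsD(1)[OF assms, of "Suc k"] by simp
  ultimately show ?thesis by (simp add: test_functions_def)
qed

lemma test_function_support:
  fixes \<phi> :: "real ^ 'd \<Rightarrow> real"
  assumes "\<phi> \<in> test_functions"
  obtains R where "R > 0" "\<And>x. norm x > R \<Longrightarrow> \<phi> x = 0"
proof -
  have "bounded (closure {x. \<phi> x \<noteq> 0})"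
    using test_functionsD(2)[OF assms] by (rule compact_imp_bounded)
  then obtain R where R: "R > 0" "\<And>x. x \<in> closure {x. \<phi> x \<noteq> 0} \<Longrightarrow> norm x \<le> R"
    by (auto simp: bounded_pos)
  show thesis
  proof (rule that[OF R(1)])
    fix x :: "real ^ 'd" assume "norm x > R"
    then show "\<phi> x = 0"
      using R(2)[of x] closure_subset[of "{x. \<phi> x \<noteq> 0}"] by force
  qed
qed

lemma test_function_bounded:
  fixes \<phi> :: "real ^ 'd \<Rightarrow> real"
  assumes "\<phi> \<in> test_functions"
  obtains C where "C \<ge> 0" "\<And>x. \<bar>\<phi> x\<bar> \<le> C"
proof -
  obtain R where R: "R > 0" "\<And>x. norm x > R \<Longrightarrow> \<phi> x = 0"
    using test_function_support[OF assms] by blast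
  have "compact (\<phi> ` cball 0 R)"
    by (intro compact_continuous_image continuous_on_subset[OF test_function_continuous[OF assms]]) auto
  then obtain C where C: "C > 0" "\<And>x. x \<in> cball 0 R \<Longrightarrow> \<bar>\<phi> x\<bar> \<le> C"
    by (force simp: bounded_pos dest!: compact_imp_bounded)
  have "\<bar>\<phi> x\<bar> \<le> C" for x
    using C R(2)[of x] by (cases "norm x \<le> R") (auto simp: not_le)
  then show thesis using that[of C] C(1) by auto
qed

lemma gradient_inner: "gradient \<phi> x \<bullet> z = (\<Sum>i\<in>UNIV. z $ i * partial_deriv i \<phi> x)"
  by (simp add: gradient_def inner_vec_def mult.commute)

lemma frechet_derivative_gradient:
  assumes "\<phi> differentiable (at x)"
  shows "frechet_derivative \<phi> (at x) z = gradient \<phi> x \<bullet> z"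
proof -
  have "linear (frechet_derivative \<phi> (at x))"
    using assms linear_frechet_derivative by blast
  then have "frechet_derivative \<phi> (at x) (\<Sum>i\<in>UNIV. z $ i *\<^sub>R axis i 1)
    = (\<Sum>i\<in>UNIV. z $ i * partial_deriv i \<phi> x)"
    by (simp add: linear_sum linear_scale partial_deriv_def)
  moreover have "(\<Sum>i\<in>UNIV. z $ i *\<^sub>R axis i 1) = z"
    by (metis basis_expansion scalar_mult_eq_scaleR)
  ultimately show ?thesis by (simp add: gradient_inner)
qed

section \<open>Taylor estimates uniform in the base point\<close>

lemma DERIV_along_line:
  fixes \<phi> :: "real ^ 'd \<Rightarrow> real"
  assumes "\<phi> \<in> test_functions"
  shows "((\<lambda>\<tau>. \<phi> (y + \<tau> *\<^sub>R z)) has_real_derivative gradient \<phi> (y + \<tau> *\<^sub>R z) \<bullet> z) (at \<tau>)"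
proof -
  have "(\<phi> has_derivative frechet_derivative \<phi> (at (y + \<tau> *\<^sub>R z))) (at (y + \<tau> *\<^sub>R z))"
    using test_functionsD(3)[OF assms] frechet_derivative_works by blast
  then have "((\<lambda>\<tau>. \<phi> (y + \<tau> *\<^sub>R z)) has_derivative
      (\<lambda>a. frechet_derivative \<phi> (at (y + \<tau> *\<^sub>R z)) (a *\<^sub>R z))) (at \<tau>)"
    by (rule has_derivative_compose[rotated]) (auto intro!: derivative_eq_intros)
  then show ?thesis
    by (simp add: has_field_derivative_def frechet_derivative_gradient[OF test_functionsD(3)[OF assms]] mult_commute_abs)
qed

lemma test_function_mvt:
  fixes \<phi> :: "real ^ 'd \<Rightarrow> real"
  assumes "\<phi> \<in> test_functions"
  obtains \<theta> where "0 < \<theta>" "\<theta> < 1" "\<phi> (y + z) - \<phi> y = gradient \<phi> (y + \<theta> *\<^sub>R z) \<bullet> z"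
  using MVT2[of 0 1 "\<lambda>\<tau>. \<phi> (y + \<tau> *\<^sub>R z)" "\<lambda>\<tau>. gradient \<phi> (y + \<tau> *\<^sub>R z) \<bullet> z"]
    DERIV_along_line[OF assms] by auto

text \<open>Turns coordinatewise bounds on a derivative into a bound on its pairing with
  \<open>z\<close>. \<open>B\<close> stands for 1 or a power of \<open>norm z\<close>, so each use
  raises the order of a remainder by one.\<close>

lemma abs_sum_mult_le:
  fixes z :: "real ^ 'd"
  assumes "\<And>i. \<bar>a i\<bar> \<le> C i * B"
  shows "\<bar>\<Sum>i\<in>UNIV. z $ i * a i\<bar> \<le> (\<Sum>i\<in>UNIV. C i) * (norm z * B)"
proof -
  have "\<bar>z $ i * a i\<bar> \<le> C i * (norm z * B)" for i
  proof -
    have "\<bar>z $ i * a i\<bar> \<le> norm z * (C i * B)"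
      unfolding abs_mult by (intro mult_mono component_le_norm_cart assms) auto
    then show ?thesis by (simp add: algebra_simps)
  qed
  then have "\<bar>\<Sum>i\<in>UNIV. z $ i * a i\<bar> \<le> (\<Sum>i\<in>UNIV. C i * (norm z * B))"
    by (intro order_trans[OF sum_abs] sum_mono) 
  then show ?thesis by (simp add: sum_distrib_right)
qed

lemma test_function_lipschitz:
  fixes \<phi> :: "real ^ 'd \<Rightarrow> real"
  assumes "\<phi> \<in> test_functions"
  obtains C where "C \<ge> 0" "\<And>x z. \<bar>\<phi> (x + z) - \<phi> x\<bar> \<le> C * norm z"
proof -
  have "\<exists>C. C \<ge> 0 \<and> (\<forall>x. \<bar>partial_deriv i \<phi> x\<bar> \<le> C)" for i
    using test_function_bounded[OF test_functions_partial_deriv[OF assms]] by metis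
  then obtain C where C: "\<And>i. C i \<ge> 0" "\<And>i x. \<bar>partial_deriv i \<phi> x\<bar> \<le> C i" by metis
  show thesis
  proof (rule that[of "\<Sum>i\<in>UNIV. C i"])
    fix x z :: "real ^ 'd"
    obtain \<theta> where "\<phi> (x + z) - \<phi> x = gradient \<phi> (x + \<theta> *\<^sub>R z) \<bullet> z"
      using test_function_mvt[OF assms] by metis
    then show "\<bar>\<phi> (x + z) - \<phi> x\<bar> \<le> sum C UNIV * norm z"
      using abs_sum_mult_le[of "\<lambda>i. partial_deriv i \<phi> (x + \<theta> *\<^sub>R z)" C 1] C(2)
      by (simp add: gradient_inner)
  qed (auto intro: sum_nonneg C)
qed

text \<open>By the mean value theorem the remainder is the pairing of \<open>z\<close> with a
  difference of gradients, and the partial derivatives are Lipschitz because they are test functions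
  themselves. The factor 1/2 of the sharp remainder is given away.\<close>

lemma test_function_taylor1:
  fixes \<phi> :: "real ^ 'd \<Rightarrow> real"
  assumes "\<phi> \<in> test_functions"
  obtains C where "C \<ge> 0" "\<And>x z. \<bar>\<phi> (x + z) - \<phi> x - gradient \<phi> x \<bullet> z\<bar> \<le> C * (norm z)\<^sup>2"
proof -
  have "\<exists>C. C \<ge> 0 \<and> (\<forall>x z. \<bar>partial_deriv i \<phi> (x + z) - partial_deriv i \<phi> x\<bar> \<le> C * norm z)" for i
    using test_function_lipschitz[OF test_functions_partial_deriv[OF assms]] by metis
  then obtain C where C: "\<And>i. C i \<ge> 0"
    "\<And>i x z. \<bar>partial_deriv i \<phi> (x + z) - partial_deriv i \<phi> x\<bar> \<le> C i * norm z" by metis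
  show thesis
  proof (rule that[of "\<Sum>i\<in>UNIV. C i"])
    fix x z :: "real ^ 'd"
    obtain \<theta> where \<theta>: "0 < \<theta>" "\<theta> < 1" "\<phi> (x + z) - \<phi> x = gradient \<phi> (x + \<theta> *\<^sub>R z) \<bullet> z"
      using test_function_mvt[OF assms] by metis
    have "\<bar>partial_deriv i \<phi> (x + \<theta> *\<^sub>R z) - partial_deriv i \<phi> x\<bar> \<le> C i * norm z" for i
    proof -
      have "C i * (\<theta> * norm z) \<le> C i * norm z"
        using \<theta> C(1)[of i] by (intro mult_left_mono) (auto simp: mult_left_le_one_le)
      then show ?thesis using C(2)[of i x "\<theta> *\<^sub>R z"] \<theta> by simp
    qed
    from abs_sum_mult_le[OF this, of z] \<theta>(3)
    show "\<bar>\<phi> (x + z) - \<phi> x - gradient \<phi> x \<bullet> z\<bar> \<le> sum C UNIV * (norm z)\<^sup>2"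
      by (simp add: gradient_inner right_diff_distrib sum_subtractf power2_eq_square)
  qed (auto intro: sum_nonneg C)
qed

text \<open>The second-order term is written through gradients of the partial derivatives. The
  derivative of the remainder along the segment is then a combination of the first-order remainders
  of the partial derivatives, to which \<open>test_function_taylor1\<close> applies.\<close>

lemma test_function_taylor2:
  fixes \<phi> :: "real ^ 'd \<Rightarrow> real"
  assumes "\<phi> \<in> test_functions"
  obtains C where "C \<ge> 0"
    "\<And>x z. \<bar>\<phi> (x + z) - \<phi> x - gradient \<phi> x \<bullet> z
        - (\<Sum>i\<in>UNIV. z $ i * (gradient (partial_deriv i \<phi>) x \<bullet> z)) / 2\<bar> \<le> C * norm z ^ 3"
proof -
  have "\<exists>C. C \<ge> 0 \<and> (\<forall>x z. \<bar>partial_deriv i \<phi> (x + z) - partial_deriv i \<phi> x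
      - gradient (partial_deriv i \<phi>) x \<bullet> z\<bar> \<le> C * (norm z)\<^sup>2)" for i
    using test_function_taylor1[OF test_functions_partial_deriv[OF assms]] by metis
  then obtain C where C: "\<And>i. C i \<ge> 0"
    "\<And>i x z. \<bar>partial_deriv i \<phi> (x + z) - partial_deriv i \<phi> x
      - gradient (partial_deriv i \<phi>) x \<bullet> z\<bar> \<le> C i * (norm z)\<^sup>2" by metis
  show thesis
  proof (rule that[of "\<Sum>i\<in>UNIV. C i"])
    fix x z :: "real ^ 'd"
    define Q where "Q = (\<Sum>i\<in>UNIV. z $ i * (gradient (partial_deriv i \<phi>) x \<bullet> z))"
    \<comment> \<open>Its increment over \<open>[0,1]\<close> is the remainder to be bounded; the
      factor 1/2 makes the quadratic term contribute exactly \<open>\<tau> * Q\<close> to the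
      derivative.\<close>
    define f where "f \<tau> = \<phi> (x + \<tau> *\<^sub>R z) - \<tau> * (gradient \<phi> x \<bullet> z) - \<tau>\<^sup>2 * Q / 2" for \<tau>
    have "DERIV f \<tau> :> gradient \<phi> (x + \<tau> *\<^sub>R z) \<bullet> z - gradient \<phi> x \<bullet> z - \<tau> * Q" for \<tau>
      unfolding f_def by (auto intro!: derivative_eq_intros DERIV_along_line assms)
    then obtain \<theta> where \<theta>: "0 < \<theta>" "\<theta> < 1"
      "f 1 - f 0 = gradient \<phi> (x + \<theta> *\<^sub>R z) \<bullet> z - gradient \<phi> x \<bullet> z - \<theta> * Q"
      using MVT2[of 0 1 f "\<lambda>\<tau>. gradient \<phi> (x + \<tau> *\<^sub>R z) \<bullet> z - gradient \<phi> x \<bullet> z - \<tau> * Q"] by auto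
    have "\<bar>partial_deriv i \<phi> (x + \<theta> *\<^sub>R z) - partial_deriv i \<phi> x
        - \<theta> * (gradient (partial_deriv i \<phi>) x \<bullet> z)\<bar> \<le> C i * (norm z)\<^sup>2" for i
    proof -
      have "C i * (norm (\<theta> *\<^sub>R z))\<^sup>2 \<le> C i * (norm z)\<^sup>2"
        using \<theta> C(1)[of i] by (intro mult_left_mono power_mono) (auto simp: mult_left_le_one_le)
      then show ?thesis using C(2)[of i x "\<theta> *\<^sub>R z"] \<theta> by simp
    qed
    from abs_sum_mult_le[OF this, of z]
    have "\<bar>f 1 - f 0\<bar> \<le> sum C UNIV * (norm z * (norm z)\<^sup>2)"
      unfolding \<theta>(3) by (simp add: Q_def gradient_inner[of \<phi>] right_diff_distrib sum_subtractf
          sum_distrib_left mult.left_commute)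
    moreover have "f 1 - f 0 = \<phi> (x + z) - \<phi> x - gradient \<phi> x \<bullet> z - Q / 2"
      by (simp add: f_def)
    ultimately show "\<bar>\<phi> (x + z) - \<phi> x - gradient \<phi> x \<bullet> z - Q / 2\<bar> \<le> sum C UNIV * norm z ^ 3"
      by (simp add: power3_eq_cube power2_eq_square mult.assoc)
  qed (auto intro: sum_nonneg C)
qed

section \<open>Joint support and global bounds for the gradient and the Laplacian\<close>

lemma test_function_joint_support:
  fixes \<phi> :: "real ^ 'd \<Rightarrow> real"
  assumes "\<phi> \<in> test_functions"
  obtains R where "R > 0"
    "\<And>x. norm x > R \<Longrightarrow> \<phi> x = 0 \<and> gradient \<phi> x = 0 \<and> laplacian \<phi> x = 0"
proof -
  obtain R where R: "R > 0" "\<And>x. norm x > R \<Longrightarrow> \<phi> x = 0"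
    using test_function_support[OF assms] by blast
  have "open {x :: real ^ 'd. norm x > R}"
    by (intro open_Collect_less continuous_intros)
  then have *: "partial_deriv i f x = 0" if "norm x > R" "\<And>y. norm y > R \<Longrightarrow> f y = 0"
    for i :: 'd and f and x :: "real ^ 'd"
    by (rule partial_deriv_eq_0) (use that in auto)
  have 1: "partial_deriv i \<phi> x = 0" if "norm x > R" for i x
    by (rule *[OF that R(2)])
  moreover have "partial_deriv i (partial_deriv i \<phi>) x = 0" if "norm x > R" for i x
    by (rule *[OF that 1])
  ultimately show thesis
    using R by (intro that[of R]) (auto simp: gradient_def laplacian_def vec_eq_iff)
qed

lemma laplacian_continuous:
  fixes \<phi> :: "real ^ 'd \<Rightarrow> real"
  assumes "\<phi> \<in> test_functions"
  shows "continuous_on UNIV (laplacian \<phi>)"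
  unfolding laplacian_def
  by (intro continuous_on_sum test_function_continuous test_functions_partial_deriv assms)

lemma gradient_continuous:
  fixes \<phi> :: "real ^ 'd \<Rightarrow> real"
  assumes "\<phi> \<in> test_functions"
  shows "continuous_on UNIV (gradient \<phi>)"
  using assms by (auto intro!: continuous_intros
      test_function_continuous test_functions_partial_deriv simp: gradient_def [abs_def])

lemma gradient_bounded:
  fixes \<phi> :: "real ^ 'd \<Rightarrow> real"
  assumes "\<phi> \<in> test_functions"
  obtains C where "C \<ge> 0" "\<And>x. norm (gradient \<phi> x) \<le> C"
proof -
  have "\<exists>C. C \<ge> 0 \<and> (\<forall>x. \<bar>partial_deriv i \<phi> x\<bar> \<le> C)" for i
    using test_function_bounded[OF test_functions_partial_deriv[OF assms]] by metis
  then obtain C where C: "\<And>i. C i \<ge> 0" "\<And>i x. \<bar>partial_deriv i \<phi> x\<bar> \<le> C i" by metis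
  show thesis
  proof (rule that[of "sum C UNIV"])
    show "norm (gradient \<phi> x) \<le> sum C UNIV" for x
      by (rule order_trans[OF norm_le_l1_cart]) (auto simp: gradient_def intro!: sum_mono C)
  qed (auto intro: sum_nonneg C)
qed

lemma laplacian_bounded:
  fixes \<phi> :: "real ^ 'd \<Rightarrow> real"
  assumes "\<phi> \<in> test_functions"
  obtains C where "C \<ge> 0" "\<And>x. \<bar>laplacian \<phi> x\<bar> \<le> C"
proof -
  have "\<exists>C. C \<ge> 0 \<and> (\<forall>x. \<bar>partial_deriv i (partial_deriv i \<phi>) x\<bar> \<le> C)" for i
    using test_function_bounded[OF test_functions_partial_deriv[OF test_functions_partial_deriv[OF assms]]] by metis
  then obtain C where C: "\<And>i. C i \<ge> 0" "\<And>i x. \<bar>partial_deriv i (partial_deriv i \<phi>) x\<bar> \<le> C i" by metis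
  show thesis
  proof (rule that[of "sum C UNIV"])
    show "\<bar>laplacian \<phi> x\<bar> \<le> sum C UNIV" for x
      unfolding laplacian_def by (rule order_trans[OF sum_abs]) (auto intro!: sum_mono C)
  qed (auto intro: sum_nonneg C)
qed

lemma laplacian_lipschitz:
  fixes \<phi> :: "real ^ 'd \<Rightarrow> real"
  assumes "\<phi> \<in> test_functions"
  obtains C where "C \<ge> 0" "\<And>x z. \<bar>laplacian \<phi> (x + z) - laplacian \<phi> x\<bar> \<le> C * norm z"
proof -
  have "\<exists>C. C \<ge> 0 \<and> (\<forall>x z. \<bar>partial_deriv i (partial_deriv i \<phi>) (x + z)
      - partial_deriv i (partial_deriv i \<phi>) x\<bar> \<le> C * norm z)" for i
    using test_function_lipschitz[OF test_functions_partial_deriv[OF test_functions_partial_deriv[OF assms]]] by metis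
  then obtain C where C: "\<And>i. C i \<ge> 0" "\<And>i x z. \<bar>partial_deriv i (partial_deriv i \<phi>) (x + z)
      - partial_deriv i (partial_deriv i \<phi>) x\<bar> \<le> C i * norm z" by metis
  show thesis
  proof (rule that[of "sum C UNIV"])
    show "\<bar>laplacian \<phi> (x + z) - laplacian \<phi> x\<bar> \<le> sum C UNIV * norm z" for x z
      unfolding laplacian_def sum_subtractf[symmetric] sum_distrib_right
      by (rule order_trans[OF sum_abs]) (auto intro!: sum_mono C)
  qed (auto intro: sum_nonneg C)
qed

section \<open>Gaussian smoothing\<close>

text \<open>By \<open>lborel_eq\<close>, Lebesgue measure on a Euclidean space is the image of the
  product measure under summation along the basis, so products of one-variable functions integrate
  factorwise.\<close>

lemma has_bochner_integral_lborel_prod: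
  fixes f :: "'a::euclidean_space \<Rightarrow> real \<Rightarrow> real"
  assumes int: "\<And>b. b \<in> Basis \<Longrightarrow> integrable lborel (f b)"
  shows "has_bochner_integral lborel (\<lambda>x. \<Prod>b\<in>Basis. f b (x \<bullet> b)) (\<Prod>b\<in>Basis. integral\<^sup>L lborel (f b))"
proof -
  interpret product_sigma_finite "\<lambda>_::'a. lborel :: real measure" ..
  have [measurable]: "\<And>b. b \<in> Basis \<Longrightarrow> f b \<in> borel_measurable borel"
    using borel_measurable_integrable[OF int] by simp
  have "has_bochner_integral (Pi\<^sub>M Basis (\<lambda>_. lborel)) (\<lambda>x. \<Prod>b\<in>Basis. f b (x b))
      (\<Prod>b\<in>Basis. integral\<^sup>L lborel (f b))"
    using product_integrable_prod[OF finite_Basis int] product_integral_prod[OF finite_Basis int]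
    by (simp add: has_bochner_integral_iff)
  also have "(\<lambda>x. \<Prod>b\<in>Basis. f b (x b)) =
      (\<lambda>x. \<Prod>b\<in>Basis. f b ((\<Sum>b\<in>Basis. x b *\<^sub>R b) \<bullet> b))"
    by (intro ext prod.cong) (auto simp: inner_sum_left_Basis)
  finally show ?thesis
    by (subst lborel_eq) (simp add: has_bochner_integral_distr)
qed

lemma has_bochner_integral_lborel_prod_cart:
  fixes f :: "'d::finite \<Rightarrow> real \<Rightarrow> real"
  assumes int: "\<And>i. integrable lborel (f i)"
  shows "has_bochner_integral (lborel :: (real ^ 'd) measure) (\<lambda>x. \<Prod>i\<in>UNIV. f i (x $ i))
    (\<Prod>i\<in>UNIV. integral\<^sup>L lborel (f i))"
proof -
  define e where "e i = (axis i 1 :: real ^ 'd)" for i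
  have inj: "inj e"
    by (auto simp: inj_def e_def axis_eq_axis)
  have Basis: "(Basis :: (real ^ 'd) set) = range e"
    by (auto simp: Basis_vec_def e_def)
  have "has_bochner_integral lborel (\<lambda>x. \<Prod>b\<in>Basis. (f \<circ> inv e) b (x \<bullet> b))
      (\<Prod>b\<in>Basis. integral\<^sup>L lborel ((f \<circ> inv e) b))"
    using int by (intro has_bochner_integral_lborel_prod) simp
  then show ?thesis
    unfolding Basis prod.reindex[OF inj] comp_def inv_f_f[OF inj]
    by (simp add: e_def inner_axis)
qed

text \<open>\<open>h\<close> is the variance, that is, the length of a time step. The density is the
  one in \<open>BM_gaussian\<close>, so that the law of a Brownian increment becomes
  \<open>gauss\<close> of the elapsed time by unfolding.\<close>

definition gauss :: "real \<Rightarrow> (real ^ 'd) measure" where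
  "gauss h = density lborel (\<lambda>x. ennreal (\<Prod>i\<in>UNIV. normal_density 0 (sqrt h) (x $ i)))"

lemma sets_gauss [simp, measurable_cong]: "sets (gauss h) = sets borel"
  by (simp add: gauss_def)

lemma space_gauss [simp]: "space (gauss h) = UNIV"
  by (simp add: gauss_def)

context
  fixes h :: real
  assumes h: "h > 0"
begin

lemma has_bochner_integral_gauss_prod:
  fixes f :: "'d::finite \<Rightarrow> real \<Rightarrow> real"
  assumes [measurable]: "\<And>i. f i \<in> borel_measurable borel"
    and int: "\<And>i. has_bochner_integral lborel (\<lambda>x. normal_density 0 (sqrt h) x * f i x) (m i)"
  shows "has_bochner_integral (gauss h) (\<lambda>x. \<Prod>i\<in>UNIV. f i (x $ i)) (\<Prod>i\<in>UNIV. m i)"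
proof -
  have "has_bochner_integral (lborel :: (real ^ 'd) measure)
     (\<lambda>x. \<Prod>i\<in>UNIV. normal_density 0 (sqrt h) (x $ i) * f i (x $ i))
     (\<Prod>i\<in>UNIV. \<integral>x. normal_density 0 (sqrt h) x * f i x \<partial>lborel)"
    by (intro has_bochner_integral_lborel_prod_cart integrable.intros[OF int])
  then have "has_bochner_integral (lborel :: (real ^ 'd) measure)
     (\<lambda>x. (\<Prod>i\<in>UNIV. normal_density 0 (sqrt h) (x $ i)) *\<^sub>R (\<Prod>i\<in>UNIV. f i (x $ i)))
     (\<Prod>i\<in>UNIV. m i)"
    by (simp add: prod.distrib has_bochner_integral_integral_eq[OF int])
  then show ?thesis
    unfolding gauss_def by (intro has_bochner_integral_density) (auto intro!: prod_nonneg)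
qed

lemma has_bochner_integral_gauss_component:
  fixes f :: "real \<Rightarrow> real" and k :: "'d::finite"
  assumes [measurable]: "f \<in> borel_measurable borel"
    and int: "has_bochner_integral lborel (\<lambda>x. normal_density 0 (sqrt h) x * f x) m"
  shows "has_bochner_integral (gauss h) (\<lambda>x. f (x $ k)) m"
proof -
  have "has_bochner_integral (gauss h) (\<lambda>x. \<Prod>i\<in>UNIV. if i = k then f (x $ i) else 1)
      (\<Prod>i\<in>UNIV. if i = k then m else 1)"
  proof (rule has_bochner_integral_gauss_prod)
    fix i
    show "has_bochner_integral lborel
      (\<lambda>x. normal_density 0 (sqrt h) x * (if i = k then f x else 1)) (if i = k then m else 1)"
      using int h by (auto simp: has_bochner_integral_iff)
  qed measurable
  then show ?thesis by (simp add: prod.delta)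
qed

lemma prob_space_gauss: "prob_space (gauss h :: (real ^ 'd::finite) measure)"
proof -
  \<comment> \<open>Total mass as a one-coordinate integral of the constant 1; the coordinate is
    arbitrary, hence \<open>undefined\<close>.\<close>
  have *: "has_bochner_integral (gauss h :: (real ^ 'd) measure) (\<lambda>_. 1) (1::real)"
    using has_bochner_integral_gauss_component[of "\<lambda>_. 1" 1 undefined] h
    by (simp add: has_bochner_integral_iff)
  then have "emeasure (gauss h :: (real ^ 'd) measure) (space (gauss h)) < \<infinity>"
    by (auto simp: has_bochner_integral_iff integrable_iff_bounded)
  then interpret finite_measure "gauss h :: (real ^ 'd) measure"
    by (intro finite_measureI) auto
  show ?thesis
    using * by (intro prob_spaceI) (simp add: has_bochner_integral_iff emeasure_eq_measure)
qed

lemma has_bochner_integral_gauss_mean: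
  "has_bochner_integral (gauss h) (\<lambda>x :: real ^ 'd::finite. x $ i) 0"
  using has_bochner_integral_gauss_component[of "\<lambda>x. x" 0 i] normal_moment_nz_1[of "sqrt h" 0] h
  by simp

lemma has_bochner_integral_gauss_covariance:
  "has_bochner_integral (gauss h) (\<lambda>x :: real ^ 'd::finite. x $ i * x $ j) (if i = j then h else 0)"
proof (cases "i = j")
  case True
  have "has_bochner_integral lborel (\<lambda>x. normal_density 0 (sqrt h) x * x\<^sup>2) h"
    using normal_moment_even[of "sqrt h" 0 1] h by (simp add: fact_2)
  from has_bochner_integral_gauss_component[OF _ this, of i] True show ?thesis
    by (simp add: power2_eq_square)
next
  case False
  \<comment> \<open>For distinct indices the product of two coordinates is a full product with
    factors 1 elsewhere, which factorises into two vanishing means.\<close>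
  have "has_bochner_integral (gauss h) (\<lambda>x. \<Prod>l\<in>UNIV. if l \<in> {i, j} then x $ l else 1)
      (\<Prod>l\<in>UNIV. if l \<in> {i, j} then 0 else 1)"
  proof (rule has_bochner_integral_gauss_prod)
    fix l
    show "has_bochner_integral lborel
      (\<lambda>x. normal_density 0 (sqrt h) x * (if l \<in> {i, j} then x else 1)) (if l \<in> {i, j} then 0 else 1)"
      using normal_moment_nz_1[of "sqrt h" 0] h by (auto simp: has_bochner_integral_iff)
  qed measurable
  moreover have "(\<Prod>l\<in>UNIV. if l \<in> {i, j} then g l else 1) = g i * g j" for g :: "'d \<Rightarrow> real"
  proof -
    have "(\<Prod>l\<in>UNIV. if l \<in> {i, j} then g l else 1) = prod g {i, j}"
      by (subst prod.inter_restrict[symmetric]) auto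
    then show ?thesis using False by simp
  qed
  ultimately show ?thesis
    using False by simp
qed

text \<open>The third absolute moment of one coordinate is
  \<open>2 * sqrt (2 / pi) * (h * sqrt h)\<close>. The cube of the norm is at most
  \<open>CARD('d) ^ 3\<close> times the cube of the largest coordinate, and replacing that
  coordinate by the sum over all of them costs the fourth factor \<open>CARD('d)\<close>. The order
  \<open>h * sqrt h\<close> is what counts: summed over about \<open>1 / h\<close> steps it still
  tends to zero.\<close>

lemma gauss_third_moment:
  "integrable (gauss h) (\<lambda>x :: real ^ 'd::finite. norm x ^ 3)"
  "(\<integral>x. norm (x :: real ^ 'd::finite) ^ 3 \<partial>gauss h)
     \<le> real CARD('d) ^ 4 * (2 * sqrt (2 / pi)) * (h * sqrt h)"
proof -
  let ?S = "\<lambda>x :: real ^ 'd. real CARD('d) ^ 3 * (\<Sum>i\<in>UNIV. \<bar>x $ i\<bar> ^ 3)"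
  have "has_bochner_integral lborel (\<lambda>x. normal_density 0 (sqrt h) x * \<bar>x\<bar> ^ 3)
     (2 * sqrt (2 / pi) * (h * sqrt h))"
    using normal_moment_abs_odd[of "sqrt h" 0 1] h by (simp add: power3_eq_cube mult_ac)
  then have "has_bochner_integral (gauss h) (\<lambda>x :: real ^ 'd. \<bar>x $ i\<bar> ^ 3) (2 * sqrt (2 / pi) * (h * sqrt h))" for i
    using has_bochner_integral_gauss_component[of "\<lambda>x. \<bar>x\<bar> ^ 3"] by auto
  then have S: "has_bochner_integral (gauss h) ?S
      (real CARD('d) ^ 3 * (\<Sum>i\<in>(UNIV::'d set). 2 * sqrt (2 / pi) * (h * sqrt h)))"
    by (intro has_bochner_integral_mult_right has_bochner_integral_sum) auto
  have le: "norm x ^ 3 \<le> ?S x" for x :: "real ^ 'd"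
  proof -
    have "Max (range (\<lambda>i. \<bar>x $ i\<bar>)) \<in> range (\<lambda>i. \<bar>x $ i\<bar>)" by (rule Max_in) auto
    then obtain k where "Max (range (\<lambda>i. \<bar>x $ i\<bar>)) = \<bar>x $ k\<bar>" by (elim imageE)
    then have k: "\<bar>x $ i\<bar> \<le> \<bar>x $ k\<bar>" for i
      using Max_ge[of "range (\<lambda>i. \<bar>x $ i\<bar>)" "\<bar>x $ i\<bar>"] by simp
    have "norm x \<le> (\<Sum>i\<in>UNIV. \<bar>x $ i\<bar>)" by (rule norm_le_l1_cart)
    also have "\<dots> \<le> real CARD('d) * \<bar>x $ k\<bar>" using k by (intro sum_bounded_above) auto
    finally have "norm x ^ 3 \<le> (real CARD('d) * \<bar>x $ k\<bar>) ^ 3" by (intro power_mono) auto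
    also have "\<dots> = real CARD('d) ^ 3 * \<bar>x $ k\<bar> ^ 3" by (rule power_mult_distrib)
    also have "\<dots> \<le> ?S x"
      by (intro mult_left_mono member_le_sum[of k UNIV "\<lambda>i. \<bar>x $ i\<bar> ^ 3"]) auto
    finally show ?thesis .
  qed
  show int: "integrable (gauss h) (\<lambda>x :: real ^ 'd. norm x ^ 3)"
    by (rule Bochner_Integration.integrable_bound[OF integrable.intros[OF S]])
       (use le in \<open>auto intro!: AE_I2 order_trans[OF _ abs_ge_self]\<close>)
  have "(\<integral>x. norm (x :: real ^ 'd) ^ 3 \<partial>gauss h) \<le> (\<integral>x. ?S x \<partial>gauss h)"
    by (intro integral_mono int integrable.intros[OF S] le)
  also have "\<dots> = real CARD('d) ^ 4 * (2 * sqrt (2 / pi)) * (h * sqrt h)"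
    by (subst has_bochner_integral_integral_eq[OF S]) (simp add: power3_eq_cube power4_eq_xxxx)
  finally show "(\<integral>x. norm (x :: real ^ 'd) ^ 3 \<partial>gauss h)
     \<le> real CARD('d) ^ 4 * (2 * sqrt (2 / pi)) * (h * sqrt h)" .
qed

end

text \<open>Integrate the second-order Taylor expansion: the linear term has mean zero, the
  covariance, \<open>h\<close> times the identity, reduces the second derivatives to the Laplacian,
  and the third moment controls the remainder. This is the source of the diffusion term of the
  PDE.\<close>

lemma gauss_expansion:
  fixes \<phi> :: "real ^ 'd \<Rightarrow> real"
  assumes \<phi>: "\<phi> \<in> test_functions" and "c \<ge> 0"
  obtains C where "C \<ge> 0"
    "\<And>h y. h > 0 \<Longrightarrow> \<bar>(\<integral>z. \<phi> (y + c *\<^sub>R z) \<partial>gauss h) - \<phi> y - h * c\<^sup>2 / 2 * laplacian \<phi> y\<bar> \<le> C * (h * sqrt h)"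
proof -
  obtain C where C: "C \<ge> 0"
    "\<And>x z. \<bar>\<phi> (x + z) - \<phi> x - gradient \<phi> x \<bullet> z
        - (\<Sum>i\<in>UNIV. z $ i * (gradient (partial_deriv i \<phi>) x \<bullet> z)) / 2\<bar> \<le> C * norm z ^ 3"
    using test_function_taylor2[OF \<phi>] by blast
  let ?C = "C * c ^ 3 * (real CARD('d) ^ 4 * (2 * sqrt (2 / pi)))"
  show thesis
  proof (rule that[of ?C])
    show "?C \<ge> 0" using C(1) \<open>c \<ge> 0\<close> by simp
    fix h :: real and y :: "real ^ 'd" assume h: "h > 0"
    interpret G: prob_space "gauss h :: (real ^ 'd) measure"
      by (rule prob_space_gauss[OF h])
    note [measurable] = test_function_measurable[OF \<phi>]
    obtain B where B: "\<And>x. \<bar>\<phi> x\<bar> \<le> B" using test_function_bounded[OF \<phi>] by metis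
    have int: "integrable (gauss h) (\<lambda>z. \<phi> (y + c *\<^sub>R z))"
      by (rule G.integrable_const_bound[of _ B]) (use B in auto)
    define Q where "Q z = (\<Sum>i\<in>UNIV. z $ i * (gradient (partial_deriv i \<phi>) y \<bullet> z))" for z
    \<comment> \<open>The value is zero, left in the shape that the introduction rules
      produce.\<close>
    have 1: "has_bochner_integral (gauss h) (\<lambda>z. c * (gradient \<phi> y \<bullet> z))
        (c * (\<Sum>i\<in>UNIV. 0 * partial_deriv i \<phi> y))"
      unfolding gradient_inner
      by (intro has_bochner_integral_mult_right has_bochner_integral_sum
          has_bochner_integral_mult_left has_bochner_integral_gauss_mean h)
    have "Q = (\<lambda>z. \<Sum>i\<in>UNIV. \<Sum>j\<in>UNIV. z $ i * z $ j * partial_deriv j (partial_deriv i \<phi>) y)"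
      by (simp add: fun_eq_iff Q_def gradient_inner sum_distrib_left mult.assoc)
    then have "has_bochner_integral (gauss h) Q
       (\<Sum>i\<in>UNIV. \<Sum>j\<in>UNIV. (if i = j then h else 0) * partial_deriv j (partial_deriv i \<phi>) y)"
      by (auto intro!: has_bochner_integral_sum
          has_bochner_integral_mult_left has_bochner_integral_gauss_covariance h)
    also have "(\<Sum>i\<in>UNIV. \<Sum>j\<in>UNIV. (if i = j then h else 0) * partial_deriv j (partial_deriv i \<phi>) y)
       = h * laplacian \<phi> y"
      by (simp add: laplacian_def sum_distrib_left if_distrib[of "\<lambda>x. x * _"] cong: if_cong)
    finally have 2: "has_bochner_integral (gauss h) Q (h * laplacian \<phi> y)" .
    let ?r = "\<lambda>z. \<phi> (y + c *\<^sub>R z) - \<phi> y - c * (gradient \<phi> y \<bullet> z) - c\<^sup>2 / 2 * Q z"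
    have "\<bar>?r z\<bar> \<le> C * c ^ 3 * norm z ^ 3" for z
      using C(2)[of y "c *\<^sub>R z"] \<open>c \<ge> 0\<close>
      by (simp add: Q_def sum_distrib_left power2_eq_square power_mult_distrib mult_ac sum_divide_distrib)
    moreover have ir: "integrable (gauss h) ?r"
      using int integrable.intros[OF 1] integrable.intros[OF 2] by simp
    ultimately have "\<bar>\<integral>z. ?r z \<partial>gauss h\<bar> \<le> (\<integral>z. C * c ^ 3 * norm (z :: real ^ 'd) ^ 3 \<partial>gauss h)"
      using gauss_third_moment[OF h]
      by (intro order_trans[OF integral_abs_bound] integral_mono) auto
    also have "\<dots> \<le> C * c ^ 3 * (real CARD('d) ^ 4 * (2 * sqrt (2 / pi)) * (h * sqrt h))"
      using C(1) \<open>c \<ge> 0\<close> gauss_third_moment[OF h, where 'd = 'd] by (simp add: mult_left_mono)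
    finally have "\<bar>\<integral>z. ?r z \<partial>gauss h\<bar> \<le> ?C * (h * sqrt h)" by (simp add: mult.assoc)
    moreover have "(\<integral>z. ?r z \<partial>gauss h) = (\<integral>z. \<phi> (y + c *\<^sub>R z) \<partial>gauss h) - \<phi> y - h * c\<^sup>2 / 2 * laplacian \<phi> y"
      using int 1 2 by (auto simp: has_bochner_integral_iff G.prob_space[simplified] mult_ac)
    ultimately show "\<bar>(\<integral>z. \<phi> (y + c *\<^sub>R z) \<partial>gauss h) - \<phi> y - h * c\<^sup>2 / 2 * laplacian \<phi> y\<bar>
        \<le> ?C * (h * sqrt h)" by simp
  qed
qed

section \<open>Lipschitz drifts and the deterministic Euler scheme\<close>

lemma set_integral_Ico_combine:
  fixes f :: "real \<Rightarrow> 'b::{banach, second_countable_topology}"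
  assumes "r \<le> s" "s \<le> t" "set_integrable lborel {r..<t} f"
  shows "(LINT x:{r..<t}|lborel. f x) = (LINT x:{r..<s}|lborel. f x) + (LINT x:{s..<t}|lborel. f x)"
proof -
  have *: "{r..<t} = {r..<s} \<union> {s..<t}" using assms by auto
  show ?thesis
    unfolding * by (intro set_integral_Un set_integrable_subset[OF assms(3)]) (use assms in auto)
qed

lemma set_integral_Icc_Ico:
  fixes f :: "real \<Rightarrow> 'b::{banach, second_countable_topology}"
  shows "(LINT x:{r..t}|lborel. f x) = (LINT x:{r..<t}|lborel. f x)"
  by (rule set_integral_discrete_difference[where X="{t}"]) auto

text \<open>The floor selects the cell that contains \<open>s\<close>, so a sum of cell integrals
  with different frozen integrands becomes one time integral, the form needed for dominated
  convergence. With an integrand independent of the cell, the same identity adds up the masses of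
  the cells.\<close>

lemma set_integral_grid:
  fixes f :: "nat \<Rightarrow> real \<Rightarrow> 'b::{banach, second_countable_topology}"
  assumes h: "h > 0" and int: "\<And>k. k < n \<Longrightarrow> set_integrable lborel {real k * h..<real (Suc k) * h} (f k)"
  shows "set_integrable lborel {0..<real n * h} (\<lambda>s. f (nat \<lfloor>s / h\<rfloor>) s) \<and>
    (LINT s:{0..<real n * h}|lborel. f (nat \<lfloor>s / h\<rfloor>) s)
      = (\<Sum>k<n. LINT s:{real k * h..<real (Suc k) * h}|lborel. f k s)"
  using int
proof (induction n)
  case 0
  then show ?case by (simp add: set_lebesgue_integral_def)
next
  case (Suc n)
  let ?g = "\<lambda>s. f (nat \<lfloor>s / h\<rfloor>) s"
  have floor: "nat \<lfloor>s / h\<rfloor> = n" if "s \<in> {real n * h..<real (Suc n) * h}" for s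
  proof -
    have "\<lfloor>s / h\<rfloor> = int n" using that h by (intro floor_unique) (auto simp: field_simps)
    then show ?thesis by simp
  qed
  have 1: "set_integrable lborel {0..<real n * h} ?g"
    and 2: "(LINT s:{0..<real n * h}|lborel. ?g s)
      = (\<Sum>k<n. LINT s:{real k * h..<real (Suc k) * h}|lborel. f k s)"
    using Suc by auto
  have 3: "set_integrable lborel {real n * h..<real (Suc n) * h} ?g"
    using Suc.prems[of n] floor by (subst set_integrable_cong[OF refl refl]) auto
  have U: "{0..<real (Suc n) * h} = {0..<real n * h} \<union> {real n * h..<real (Suc n) * h}"
    using h by (intro ivl_disj_un_two(3)[symmetric] mult_right_mono) auto
  have 4: "(LINT s:{real n * h..<real (Suc n) * h}|lborel. ?g s) =
    (LINT s:{real n * h..<real (Suc n) * h}|lborel. f n s)"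
    using floor by (intro set_lebesgue_integral_cong) auto
  have "set_integrable lborel {0..<real (Suc n) * h} ?g"
    unfolding U by (intro set_integrable_Un 1 3) auto
  moreover have "(LINT s:{0..<real (Suc n) * h}|lborel. ?g s)
      = (LINT s:{0..<real n * h}|lborel. ?g s) + (LINT s:{real n * h..<real (Suc n) * h}|lborel. ?g s)"
    unfolding U by (intro set_integral_Un 1 3) auto
  ultimately show ?case using 2 4 by simp
qed

lemma set_integrable_lborel_const:
  fixes c :: "'b::{banach, second_countable_topology}"
  assumes "A \<in> sets borel" "A \<subseteq> {r..t :: real}"
  shows "set_integrable lborel A (\<lambda>_. c)"
  by (rule set_integrable_subset[OF borel_integrable_atLeastAtMost'[of r t]]) (use assms in auto)

locale lipschitz_drift =
  fixes b :: "real \<Rightarrow> real ^ 'd \<Rightarrow> real ^ 'd" and T L :: real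
  assumes T_pos: "T > 0" and L_nonneg: "L \<ge> 0"
    and b_measurable' : "(\<lambda>(s, x). b s x) \<in> borel_measurable (borel \<Otimes>\<^sub>M borel)"
    and b_lipschitz: "norm (b s x - b s y) \<le> L * norm (x - y)"
    and b_integrable: "set_integrable lborel {0..T} (\<lambda>s. b s 0)"
begin

lemma b_measurable [measurable (raw)]:
  assumes "f \<in> borel_measurable N" "g \<in> borel_measurable N"
  shows "(\<lambda>x. b (f x) (g x)) \<in> borel_measurable N"
  using measurable_compose[OF measurable_Pair[OF assms] b_measurable'] by simp

lemma b_bound: "norm (b s x) \<le> norm (b s 0) + L * norm x"
  using norm_triangle_ineq[of "b s 0" "b s x - b s 0"] b_lipschitz[of s x 0] by simp

lemma set_integrable_b:
  assumes f: "f \<in> borel_measurable borel"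
    and A: "A \<in> sets borel" "A \<subseteq> {0..T}" and "\<And>s. s \<in> A \<Longrightarrow> norm (f s) \<le> K"
  shows "set_integrable lborel A (\<lambda>s. b s (f s))"
proof (rule set_integrable_bound)
  have "set_integrable lborel {0..T} (\<lambda>s. norm (b s 0) + L * K)"
    using set_integrable_norm[OF b_integrable]
    by (intro set_integral_add set_integrable_lborel_const[of _ 0 T]) auto
  then show "set_integrable lborel A (\<lambda>s. norm (b s 0) + L * K)"
    by (rule set_integrable_subset) (use A in auto)
  show "set_borel_measurable lborel A (\<lambda>s. b s (f s))"
    unfolding set_borel_measurable_def using f A(1) by measurable
  show "AE s in lborel. s \<in> A \<longrightarrow> norm (b s (f s)) \<le> norm (norm (b s 0) + L * K)"
  proof (intro AE_I2 impI)
    fix s assume "s \<in> A"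
    have "norm (b s (f s)) \<le> norm (b s 0) + L * norm (f s)" by (rule b_bound)
    also have "\<dots> \<le> norm (b s 0) + L * K"
      using assms(4)[OF \<open>s \<in> A\<close>] L_nonneg by (simp add: mult_left_mono)
    finally show "norm (b s (f s)) \<le> norm (norm (b s 0) + L * K)" by simp
  qed
qed

text \<open>The drift part of an Euler step. It uses the exact time integral because a drift that is
  only integrable in time has no meaningful point value \<open>b r x\<close> to multiply with the
  step length.\<close>

definition incr :: "real \<Rightarrow> real \<Rightarrow> real ^ 'd \<Rightarrow> real ^ 'd" where
  "incr r r' x = (LINT s:{r..<r'}|lborel. b s x)"

text \<open>Takes the place that a multiple of \<open>r' - r\<close> would have for a bounded
  drift.\<close>

definition mass :: "real \<Rightarrow> real \<Rightarrow> real" where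
  "mass r r' = (LINT s:{r..<r'}|lborel. norm (b s 0))"

lemma incr_measurable [measurable]: "incr r r' \<in> borel_measurable borel"
  unfolding incr_def [abs_def] set_lebesgue_integral_def by measurable

lemma set_integrable_norm_b: "0 \<le> r \<Longrightarrow> r' \<le> T \<Longrightarrow> set_integrable lborel {r..<r'} (\<lambda>s. norm (b s 0))"
  by (rule set_integrable_subset[OF set_integrable_norm[OF b_integrable]]) auto

lemma mass_nonneg: "mass r r' \<ge> 0"
  unfolding mass_def set_lebesgue_integral_def by (intro integral_nonneg_AE) auto

lemma mass_split: "0 \<le> r \<Longrightarrow> r \<le> s \<Longrightarrow> s \<le> t \<Longrightarrow> t \<le> T \<Longrightarrow> mass r t = mass r s + mass s t"
  unfolding mass_def by (intro set_integral_Ico_combine set_integrable_norm_b) auto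

lemma norm_incr_le:
  assumes "0 \<le> r" "r \<le> r'" "r' \<le> T"
  shows "norm (incr r r' x) \<le> mass r r' + L * norm x * (r' - r)"
proof -
  have int: "set_integrable lborel {r..<r'} (\<lambda>s. b s x)"
    using assms by (intro set_integrable_b[of "\<lambda>_. x" _ "norm x"]) auto
  have c: "set_integrable lborel {r..<r'} (\<lambda>s. L * norm x)"
    by (rule set_integrable_lborel_const[of _ r r']) auto
  have "norm (incr r r' x) \<le> (LINT s:{r..<r'}|lborel. norm (b s x))"
    unfolding incr_def by (rule set_integral_norm_bound[OF int])
  also have "\<dots> \<le> (LINT s:{r..<r'}|lborel. norm (b s 0) + L * norm x)"
    using assms by (intro set_integral_mono set_integrable_norm[OF int] set_integral_add
        set_integrable_norm_b c b_bound) auto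
  also have "\<dots> = mass r r' + L * norm x * (r' - r)"
    using assms by (subst set_integral_add) (auto simp: set_integrable_norm_b c mass_def set_integral_const)
  finally show ?thesis .
qed

text \<open>Absolute continuity of the integral, obtained from uniform continuity of the primitive
  \<open>mass 0\<close> on the compact interval.\<close>

lemma mass_uniformly_small:
  assumes "\<epsilon> > 0"
  obtains h0 where "h0 > 0"
    "\<And>r r'. 0 \<le> r \<Longrightarrow> r \<le> r' \<Longrightarrow> r' \<le> T \<Longrightarrow> r' - r < h0 \<Longrightarrow> mass r r' < \<epsilon>"
proof -
  have int: "set_integrable lborel {0..T} (\<lambda>s. norm (b s 0))"
    by (rule set_integrable_norm[OF b_integrable])
  have eq: "mass 0 t = integral {0..t} (\<lambda>s. norm (b s 0))" if "t \<in> {0..T}" for t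
  proof -
    have "set_integrable lborel {0..t} (\<lambda>s. norm (b s 0))"
      by (rule set_integrable_subset[OF int]) (use that in auto)
    then show ?thesis
      unfolding mass_def set_integral_Icc_Ico[symmetric] by (rule set_borel_integral_eq_integral(2))
  qed
  have "continuous_on {0..T} (\<lambda>t. integral {0..t} (\<lambda>s. norm (b s 0)))"
    by (rule indefinite_integral_continuous_1[OF set_borel_integral_eq_integral(1)[OF int]])
  then have "continuous_on {0..T} (mass 0)"
    by (rule continuous_on_eq) (simp add: eq)
  then have "uniformly_continuous_on {0..T} (mass 0)"
    by (rule compact_uniformly_continuous) simp
  then obtain h0 where h0: "h0 > 0" "\<And>r r'. r \<in> {0..T} \<Longrightarrow> r' \<in> {0..T} \<Longrightarrow> dist r' r < h0
      \<Longrightarrow> dist (mass 0 r') (mass 0 r) < \<epsilon>"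
    using assms unfolding uniformly_continuous_on_def by metis
  show thesis
  proof (rule that[OF h0(1)])
    fix r r' assume "0 \<le> r" "r \<le> r'" "r' \<le> T" "r' - r < h0"
    then show "mass r r' < \<epsilon>"
      using h0(2)[of r r'] mass_split[of 0 r r'] by (auto simp: dist_real_def)
  qed
qed

text \<open>
  Compact support makes the bound uniform in \<open>x\<close>: beyond a fixed radius the Euler step cannot
  bring \<open>x\<close> back into the support, so no moment bounds are ever required.
\<close>

lemma one_step_expansion:
  assumes \<phi>: "\<phi> \<in> test_functions" and c: "c \<ge> 0"
  obtains C K h0 where "C \<ge> 0" "K \<ge> 0" "h0 > 0"
    "\<And>r r' x. 0 \<le> r \<Longrightarrow> r < r' \<Longrightarrow> r' \<le> T \<Longrightarrow> r' - r < h0 \<Longrightarrow>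
      \<bar>(\<integral>z. \<phi> (x + incr r r' x + c *\<^sub>R z) \<partial>gauss (r' - r)) - \<phi> x
        - (gradient \<phi> x \<bullet> incr r r' x + (r' - r) * (c\<^sup>2 / 2 * laplacian \<phi> x))\<bar>
      \<le> C * ((mass r r' + K * (r' - r)) * (mass r r' + K * (r' - r) + (r' - r))
          + (r' - r) * sqrt (r' - r))"
proof -
  obtain R where R: "R > 0"
    "\<And>x. norm x > R \<Longrightarrow> \<phi> x = 0 \<and> gradient \<phi> x = 0 \<and> laplacian \<phi> x = 0"
    using test_function_joint_support[OF \<phi>] by blast
  obtain C1 where C1: "C1 \<ge> 0" "\<And>x z. \<bar>\<phi> (x + z) - \<phi> x - gradient \<phi> x \<bullet> z\<bar> \<le> C1 * (norm z)\<^sup>2"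
    using test_function_taylor1[OF \<phi>] by blast
  obtain C2 where C2: "C2 \<ge> 0" "\<And>x z. \<bar>laplacian \<phi> (x + z) - laplacian \<phi> x\<bar> \<le> C2 * norm z"
    using laplacian_lipschitz[OF \<phi>] by blast
  obtain C3 where C3: "C3 \<ge> 0"
    "\<And>h y. h > 0 \<Longrightarrow> \<bar>(\<integral>z. \<phi> (y + c *\<^sub>R z) \<partial>gauss h) - \<phi> y - h * c\<^sup>2 / 2 * laplacian \<phi> y\<bar> \<le> C3 * (h * sqrt h)"
    using gauss_expansion[OF \<phi> c] by blast
  obtain h1 where h1: "h1 > 0"
    "\<And>r r'. 0 \<le> r \<Longrightarrow> r \<le> r' \<Longrightarrow> r' \<le> T \<Longrightarrow> r' - r < h1 \<Longrightarrow> mass r r' < 1"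
    using mass_uniformly_small[of 1] by auto
  \<comment> \<open>Beyond \<open>R1\<close> the step satisfies
    \<open>norm D \<le> 1 + norm x / 2\<close>, hence
    \<open>norm (x + D) \<ge> norm x / 2 - 1 > R\<close>. Inside, the growth term
    \<open>L * norm x * h\<close> is at most \<open>K * h\<close>.\<close>
  define R1 where "R1 = 2 * (R + 1)"
  define K where "K = L * R1"
  \<comment> \<open>Ensures that the mass of a cell is below 1 and that
    \<open>L * h \<le> 1 / 2\<close>, the two facts behind the bound on \<open>D\<close> far from
    the support.\<close>
  define h0 where "h0 = min h1 (1 / (2 * (L + 1)))"
  define C where "C = C1 + c\<^sup>2 / 2 * C2 + C3"
  have K: "K \<ge> 0" using L_nonneg R(1) by (simp add: K_def R1_def)
  have C: "C \<ge> 0" using C1 C2 C3 c by (simp add: C_def)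
  have h0: "h0 > 0" using h1 L_nonneg by (simp add: h0_def)
  show thesis
  proof (rule that[OF C K h0])
    fix r r' x assume r: "0 \<le> r" "r < r'" "r' \<le> T" "r' - r < h0"
    define h where "h = r' - r"
    define D where "D = incr r r' x"
    define \<rho> where "\<rho> = mass r r' + K * h"
    have h: "h > 0" "h < h1" and Lh: "L * h \<le> 1 / 2"
    proof -
      show "h > 0" "h < h1" using r by (auto simp: h_def h0_def)
      have "h * (2 * (L + 1)) \<le> 1"
        using r L_nonneg by (auto simp: h_def h0_def pos_less_divide_eq)
      then have "2 * (L * h) + 2 * h \<le> 1" by (simp add: algebra_simps)
      then show "L * h \<le> 1 / 2" using \<open>h > 0\<close> by linarith
    qed
    have \<rho>: "\<rho> \<ge> 0" using mass_nonneg K h by (simp add: \<rho>_def)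
    have Dle: "norm D \<le> mass r r' + L * norm x * h"
      using norm_incr_le[of r r' x] r by (simp add: D_def h_def)
    have G: "\<bar>(\<integral>z. \<phi> (x + D + c *\<^sub>R z) \<partial>gauss h) - \<phi> (x + D) - h * c\<^sup>2 / 2 * laplacian \<phi> (x + D)\<bar>
        \<le> C3 * (h * sqrt h)" using C3(2)[OF h(1)] .
    have "\<bar>\<phi> (x + D) - \<phi> x - gradient \<phi> x \<bullet> D + h * c\<^sup>2 / 2 * (laplacian \<phi> (x + D) - laplacian \<phi> x)\<bar>
        \<le> C1 * \<rho>\<^sup>2 + h * c\<^sup>2 / 2 * (C2 * \<rho>)"
    proof (cases "norm x \<le> R1")
      case True
      have "L * norm x * h \<le> K * h"
        using True L_nonneg h by (simp add: K_def mult_left_mono mult_right_mono)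
      then have D\<rho>: "norm D \<le> \<rho>" using Dle by (simp add: \<rho>_def)
      have "\<bar>\<phi> (x + D) - \<phi> x - gradient \<phi> x \<bullet> D\<bar> \<le> C1 * \<rho>\<^sup>2"
        using C1(1) D\<rho> by (intro order_trans[OF C1(2)] mult_left_mono power_mono) auto
      moreover have "\<bar>laplacian \<phi> (x + D) - laplacian \<phi> x\<bar> \<le> C2 * \<rho>"
        using C2(1) D\<rho> by (intro order_trans[OF C2(2)] mult_left_mono) auto
      then have "\<bar>h * c\<^sup>2 / 2 * (laplacian \<phi> (x + D) - laplacian \<phi> x)\<bar> \<le> h * c\<^sup>2 / 2 * (C2 * \<rho>)"
        using h by (simp add: abs_mult mult_left_mono)
      ultimately show ?thesis by linarith
    next
      case False
      have "L * norm x * h \<le> norm x / 2"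
        using mult_right_mono[OF Lh, of "norm x"] by (simp add: mult_ac)
      moreover have "mass r r' < 1" using h1(2) r h by (simp add: h_def)
      ultimately have "norm D \<le> 1 + norm x / 2" using Dle by linarith
      moreover have "norm x \<le> norm (x + D) + norm D"
        using norm_triangle_ineq4[of "x + D" D] by simp
      ultimately have "norm (x + D) > R" using False by (simp add: R1_def)
      moreover have "norm x > R" using False R(1) by (simp add: R1_def)
      ultimately show ?thesis
        using R(2)[of x] R(2)[of "x + D"] C1(1) C2(1) h \<rho> by simp
    qed
    with G have "\<bar>(\<integral>z. \<phi> (x + D + c *\<^sub>R z) \<partial>gauss h) - \<phi> x - (gradient \<phi> x \<bullet> D + h * (c\<^sup>2 / 2 * laplacian \<phi> x))\<bar>
      \<le> C1 * \<rho>\<^sup>2 + h * c\<^sup>2 / 2 * (C2 * \<rho>) + C3 * (h * sqrt h)"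
      by (simp add: right_diff_distrib abs_le_iff)
    also have "\<dots> \<le> C * (\<rho> * (\<rho> + h) + h * sqrt h)"
    proof -
      define a where "a = c\<^sup>2 / 2 * C2"
      have c2: "a \<ge> 0" using C2(1) by (simp add: a_def)
      \<comment> \<open>This is the exact surplus of the right-hand side over the left after
        expanding \<open>C = C1 + a + C3\<close>.\<close>
      have "0 \<le> C1 * (\<rho> * h + h * sqrt h) + a * (\<rho> * \<rho> + h * sqrt h) + C3 * (\<rho> * (\<rho> + h))"
        using \<rho> h C1(1) C3(1) c2 by (intro add_nonneg_nonneg mult_nonneg_nonneg) auto
      moreover have a: "h * c\<^sup>2 / 2 * (C2 * \<rho>) = a * (\<rho> * h)" and C: "C = C1 + a + C3"
        by (simp_all add: a_def C_def)
      ultimately show ?thesis unfolding a C by (simp add: algebra_simps power2_eq_square)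
    qed
    finally show "\<bar>(\<integral>z. \<phi> (x + incr r r' x + c *\<^sub>R z) \<partial>gauss (r' - r)) - \<phi> x
        - (gradient \<phi> x \<bullet> incr r r' x + (r' - r) * (c\<^sup>2 / 2 * laplacian \<phi> x))\<bar>
      \<le> C * ((mass r r' + K * (r' - r)) * (mass r r' + K * (r' - r) + (r' - r))
          + (r' - r) * sqrt (r' - r))"
      by (simp add: h_def D_def \<rho>_def)
  qed
qed

section \<open>Pathwise convergence of the Euler scheme\<close>

primrec euler :: "real \<Rightarrow> real \<Rightarrow> (real \<Rightarrow> real ^ 'd) \<Rightarrow> real ^ 'd \<Rightarrow> nat \<Rightarrow> real ^ 'd" where
  "euler c h w x0 0 = x0"
| "euler c h w x0 (Suc k) = euler c h w x0 k
     + incr (real k * h) (real (Suc k) * h) (euler c h w x0 k)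
     + c *\<^sub>R (w (real (Suc k) * h) - w (real k * h))"

text \<open>Continuity on the whole line is what paths clamped to \<open>[0,T]\<close> have, and it
  gives Borel measurability of the path directly. The half-open time interval lets integrals over
  consecutive cells be concatenated.\<close>

definition integral_solution :: "real \<Rightarrow> (real \<Rightarrow> real ^ 'd) \<Rightarrow> (real \<Rightarrow> real ^ 'd) \<Rightarrow> bool" where
  "integral_solution c w x \<longleftrightarrow> continuous_on UNIV x \<and>
     (\<forall>r\<in>{0..T}. x r = x 0 + (LINT s:{0..<r}|lborel. b s (x s)) + c *\<^sub>R w r)"

lemma set_integrable_b_continuous:
  assumes "continuous_on UNIV x" "0 \<le> r" "r' \<le> T"
  shows "set_integrable lborel {r..<r'} (\<lambda>s. b s (x s))"
proof -
  have "compact (x ` {0..T})"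
    by (intro compact_continuous_image continuous_on_subset[OF assms(1)]) auto
  then obtain K where K: "\<And>s. s \<in> {0..T} \<Longrightarrow> norm (x s) \<le> K"
    by (force simp: bounded_pos dest!: compact_imp_bounded)
  show ?thesis
    using assms by (intro set_integrable_b[of x _ K] borel_measurable_continuous_onI K) auto
qed

lemma integral_solution_increment:
  assumes x: "integral_solution c w x" and r: "0 \<le> r" "r \<le> r'" "r' \<le> T"
  shows "x r' = x r + (LINT s:{r..<r'}|lborel. b s (x s)) + c *\<^sub>R (w r' - w r)"
proof -
  have x': "continuous_on UNIV x" "\<And>r. r \<in> {0..T} \<Longrightarrow> x r = x 0 + (LINT s:{0..<r}|lborel. b s (x s)) + c *\<^sub>R w r"
    using x unfolding integral_solution_def by blast+
  have "(LINT s:{0..<r'}|lborel. b s (x s)) = (LINT s:{0..<r}|lborel. b s (x s)) + (LINT s:{r..<r'}|lborel. b s (x s))"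
    using r by (intro set_integral_Ico_combine set_integrable_b_continuous x'(1)) auto
  then show ?thesis
    using x'(2)[of r] x'(2)[of r'] r by (simp add: scaleR_diff_right)
qed

lemma euler_error:
  assumes x: "integral_solution c w x" and h: "h > 0"
    and modulus: "\<And>r s. 0 \<le> r \<Longrightarrow> r \<le> s \<Longrightarrow> s \<le> T \<Longrightarrow> s - r \<le> h \<Longrightarrow> norm (x s - x r) \<le> \<eta>"
  shows "real k * h \<le> T \<Longrightarrow> norm (euler c h w (x 0) k - x (real k * h)) + \<eta> \<le> (1 + L * h) ^ k * \<eta>"
proof (induction k)
  case 0
  then show ?case by simp
next
  case (Suc k)
  define r r' y where "r = real k * h" and "r' = real (Suc k) * h" and "y = euler c h w (x 0) k"
  have r: "0 \<le> r" "r \<le> r'" "r' \<le> T" "r' - r = h"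
    using h Suc.prems by (auto simp: r_def r'_def algebra_simps)
  have IH: "norm (y - x r) + \<eta> \<le> (1 + L * h) ^ k * \<eta>"
    using Suc.IH r by (simp add: r_def y_def)
  have x': "continuous_on UNIV x" using x by (simp add: integral_solution_def)
  have int: "set_integrable lborel {r..<r'} (\<lambda>s. b s (x s))"
    using r by (intro set_integrable_b_continuous x') auto
  have int': "set_integrable lborel {r..<r'} (\<lambda>s. b s y)"
    using r by (intro set_integrable_b[of "\<lambda>_. y" _ "norm y"]) auto
  note int'' = set_integral_diff[OF int' int]
  have "norm (incr r r' y - (LINT s:{r..<r'}|lborel. b s (x s)))
      = norm (LINT s:{r..<r'}|lborel. b s y - b s (x s))"
    by (simp add: incr_def int''(2))
  also have "\<dots> \<le> (LINT s:{r..<r'}|lborel. norm (b s y - b s (x s)))"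
    by (rule set_integral_norm_bound[OF int''(1)])
  also have "\<dots> \<le> (LINT s:{r..<r'}|lborel. L * (norm (y - x r) + \<eta>))"
  proof (intro set_integral_mono set_integrable_norm[OF int''(1)] set_integrable_lborel_const[of _ r r'])
    fix s assume s: "s \<in> {r..<r'}"
    have "norm (b s y - b s (x s)) \<le> L * norm (y - x s)" by (rule b_lipschitz)
    also have "norm (y - x s) \<le> norm (y - x r) + norm (x s - x r)"
      using norm_triangle_ineq4[of "y - x r" "x s - x r"] by simp
    also have "norm (x s - x r) \<le> \<eta>" using s r by (intro modulus) auto
    finally show "norm (b s y - b s (x s)) \<le> L * (norm (y - x r) + \<eta>)"
      using L_nonneg by (simp add: mult_left_mono)
  qed auto
  also have "\<dots> = L * h * (norm (y - x r) + \<eta>)"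
    using r by (simp add: set_integral_const)
  finally have 1: "norm (incr r r' y - (LINT s:{r..<r'}|lborel. b s (x s))) \<le> L * h * (norm (y - x r) + \<eta>)" .
  have eq: "euler c h w (x 0) (Suc k) - x r' = (y - x r) + (incr r r' y - (LINT s:{r..<r'}|lborel. b s (x s)))"
    using integral_solution_increment[OF x r(1-3)] by (simp add: y_def r_def r'_def)
  have "norm (euler c h w (x 0) (Suc k) - x r') + \<eta> \<le> (1 + L * h) * (norm (y - x r) + \<eta>)"
    unfolding eq using norm_triangle_le[OF add_left_mono[OF 1, of "norm (y - x r)"]]
    by (simp add: algebra_simps)
  also have "\<dots> \<le> (1 + L * h) * ((1 + L * h) ^ k * \<eta>)"
    using IH L_nonneg h by (intro mult_left_mono) auto
  finally show ?case by (simp add: r'_def mult.assoc)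
qed

lemma euler_tendsto:
  assumes x: "integral_solution c w x" and t: "0 < t" "t \<le> T" and s: "0 \<le> s" "s \<le> t"
  shows "(\<lambda>n. euler c (t / real n) w (x 0) (nat \<lfloor>s / (t / real n)\<rfloor>)) \<longlonglongrightarrow> x s"
proof (rule LIMSEQ_I)
  fix \<epsilon> :: real assume \<epsilon>: "\<epsilon> > 0"
  define \<eta> where "\<eta> = \<epsilon> / (2 * exp (L * T))"
  have \<eta>: "\<eta> > 0" "exp (L * T) * \<eta> < \<epsilon>" using \<epsilon> by (auto simp: \<eta>_def)
  have "continuous_on {0..T} x"
    using x continuous_on_subset by (auto simp: integral_solution_def)
  then have "uniformly_continuous_on {0..T} x"
    by (rule compact_uniformly_continuous) simp
  then obtain \<delta> where \<delta>: "\<delta> > 0"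
    "\<And>r s. r \<in> {0..T} \<Longrightarrow> s \<in> {0..T} \<Longrightarrow> dist s r < \<delta> \<Longrightarrow> dist (x s) (x r) < \<eta>"
    using \<eta>(1) unfolding uniformly_continuous_on_def by metis
  obtain N where N: "real N > t / \<delta>" using reals_Archimedean2 by blast
  show "\<exists>N. \<forall>n\<ge>N. norm (euler c (t / real n) w (x 0) (nat \<lfloor>s / (t / real n)\<rfloor>) - x s) < \<epsilon>"
  \<comment> \<open>The 1 excludes \<open>n = 0\<close>, where the step \<open>t / real n\<close>
    would be 0.\<close>
  proof (intro exI[of _ "max N 1"] allI impI)
    fix n assume n: "n \<ge> max N 1"
    define h where "h = t / real n"
    define k where "k = nat \<lfloor>s / h\<rfloor>"
    have h: "h > 0" using n t by (simp add: h_def)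
    have "t / \<delta> < real n" using n N by (meson less_le_trans max.boundedE of_nat_le_iff)
    then have h\<delta>: "h < \<delta>" using n \<delta>(1) by (simp add: h_def field_simps)
    have k: "real k \<le> s / h" "s / h < real k + 1"
      using s h by (auto simp: k_def)
    then have ks: "real k * h \<le> s" "s - real k * h \<le> h"
      using h by (auto simp: field_simps)
    have modulus: "norm (x s - x r) \<le> \<eta>" if "0 \<le> r" "r \<le> s" "s \<le> T" "s - r \<le> h" for r s
      using \<delta>(2)[of r s] that h\<delta> by (auto simp: dist_norm)
    have "norm (euler c h w (x 0) k - x s) \<le> norm (euler c h w (x 0) k - x (real k * h)) + norm (x s - x (real k * h))"
      using norm_triangle_ineq4[of "euler c h w (x 0) k - x (real k * h)" "x s - x (real k * h)"] by simp
    also have "norm (x s - x (real k * h)) \<le> \<eta>"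
      using ks s t h by (intro modulus) auto
    \<comment> \<open>The \<open>\<eta>\<close> spent in moving from \<open>s\<close> to the grid
      point on its left is the one already carried by \<open>euler_error\<close>, so the total is at
      most \<open>exp (L * T) * \<eta> < \<epsilon>\<close>.\<close>
    also have "norm (euler c h w (x 0) k - x (real k * h)) + \<eta> \<le> (1 + L * h) ^ k * \<eta>"
      using ks s t by (intro euler_error[OF x h modulus]) auto
    also have "(1 + L * h) ^ k \<le> exp (L * h) ^ k"
      using L_nonneg h by (intro power_mono exp_ge_add_one_self) auto
    also have "exp (L * h) ^ k = exp (L * (real k * h))"
      by (simp add: exp_of_nat_mult[symmetric] mult_ac)
    also have "\<dots> \<le> exp (L * T)"
      using ks s t L_nonneg by (simp add: mult_left_mono)
    also note \<eta>(2)
    finally show "norm (euler c (t / real n) w (x 0) (nat \<lfloor>s / (t / real n)\<rfloor>) - x s) < \<epsilon>"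
      using \<eta>(1) by (simp add: h_def k_def)
  qed
qed

section \<open>The generator and its majorant in time\<close>

definition generator :: "real \<Rightarrow> (real ^ 'd \<Rightarrow> real) \<Rightarrow> real \<Rightarrow> real ^ 'd \<Rightarrow> real" where
  "generator c \<phi> s x = gradient \<phi> x \<bullet> b s x + c\<^sup>2 / 2 * laplacian \<phi> x"

text \<open>The gradient vanishes outside a ball, which cuts off the linear growth of
  \<open>b s\<close> in the state. The result is a majorant depending on time only, common to the
  solution and to all Euler schemes.\<close>

lemma generator_bound:
  assumes \<phi>: "\<phi> \<in> test_functions"
  obtains C where "C \<ge> 0" "\<And>s x. \<bar>generator c \<phi> s x\<bar> \<le> C * (norm (b s 0) + 1)"
proof -
  obtain R where R: "R > 0"
    "\<And>x. norm x > R \<Longrightarrow> \<phi> x = 0 \<and> gradient \<phi> x = 0 \<and> laplacian \<phi> x = 0"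
    using test_function_joint_support[OF \<phi>] by blast
  obtain A where A: "A \<ge> 0" "\<And>x. norm (gradient \<phi> x) \<le> A"
    using gradient_bounded[OF \<phi>] by blast
  obtain B where B: "B \<ge> 0" "\<And>x. \<bar>laplacian \<phi> x\<bar> \<le> B"
    using laplacian_bounded[OF \<phi>] by blast
  let ?C = "A * (1 + L * R) + c\<^sup>2 / 2 * B"
  show thesis
  proof (rule that[of ?C])
    show "?C \<ge> 0" using A B R L_nonneg by simp
    fix s x
    have lap: "\<bar>c\<^sup>2 / 2 * laplacian \<phi> x\<bar> \<le> c\<^sup>2 / 2 * B"
      using B(2)[of x] by (simp add: abs_mult mult_left_mono)
    have "\<bar>gradient \<phi> x \<bullet> b s x\<bar> \<le> A * (norm (b s 0) + L * R)"
    proof (cases "norm x > R")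
      case True
      then show ?thesis using R A L_nonneg by simp
    next
      case False
      have "L * norm x \<le> L * R" using False L_nonneg by (intro mult_left_mono) auto
      then have "norm (b s x) \<le> norm (b s 0) + L * R" using b_bound[of s x] by linarith
      then show ?thesis
        by (intro order_trans[OF Cauchy_Schwarz_ineq2] mult_mono A) auto
    qed
    then have "\<bar>generator c \<phi> s x\<bar> \<le> A * (norm (b s 0) + L * R) + c\<^sup>2 / 2 * B"
      unfolding generator_def using lap by linarith
    also have "\<dots> \<le> ?C * (norm (b s 0) + 1)"
    proof -
      define a where "a = c\<^sup>2 / 2 * B"
      have "0 \<le> A * (1 + L * R * norm (b s 0)) + a * norm (b s 0)"
        using A B R L_nonneg by (simp add: a_def)
      then show ?thesis unfolding a_def[symmetric] by (simp add: algebra_simps)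
    qed
    finally show "\<bar>generator c \<phi> s x\<bar> \<le> ?C * (norm (b s 0) + 1)" .
  qed
qed

lemma generator_measurable:
  assumes \<phi>: "\<phi> \<in> test_functions" and [measurable]: "f \<in> borel_measurable N" "g \<in> borel_measurable N"
  shows "(\<lambda>x. generator c \<phi> (f x) (g x)) \<in> borel_measurable N"
proof -
  have [measurable]: "gradient \<phi> \<in> borel_measurable borel" "laplacian \<phi> \<in> borel_measurable borel"
    using gradient_continuous[OF \<phi>] laplacian_continuous[OF \<phi>] by (auto intro: borel_measurable_continuous_onI)
  show ?thesis unfolding generator_def by measurable
qed

lemma generator_continuous:
  assumes \<phi>: "\<phi> \<in> test_functions"
  shows "continuous_on UNIV (generator c \<phi> s)"
proof -
  have "L-lipschitz_on UNIV (b s)"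
    using b_lipschitz L_nonneg by (intro lipschitz_onI) (auto simp: dist_norm)
  then have "continuous_on UNIV (b s)" by (rule lipschitz_on_continuous_on)
  then show ?thesis
    unfolding generator_def using gradient_continuous[OF \<phi>] laplacian_continuous[OF \<phi>]
    by (intro continuous_intros)
qed

lemma set_integrable_generator_bound:
  assumes "A \<in> sets borel" "A \<subseteq> {0..T}"
  shows "set_integrable lborel A (\<lambda>s. C * (norm (b s 0) + 1))"
proof -
  have "set_integrable lborel {0..T} (\<lambda>s. C * (norm (b s 0) + 1))"
    by (intro set_integrable_mult_right set_integral_add set_integrable_norm[OF b_integrable]
        set_integrable_lborel_const[of _ 0 T]) auto
  then show ?thesis by (rule set_integrable_subset) (use assms in auto)
qed

lemma set_integrable_generator:
  assumes \<phi>: "\<phi> \<in> test_functions" and f: "f \<in> borel_measurable borel"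
    and A: "A \<in> sets borel" "A \<subseteq> {0..T}"
  shows "set_integrable lborel A (\<lambda>s. generator c \<phi> s (f s))"
proof -
  obtain C where C: "C \<ge> 0" "\<And>s x. \<bar>generator c \<phi> s x\<bar> \<le> C * (norm (b s 0) + 1)"
    using generator_bound[OF \<phi>] by blast
  show ?thesis
  proof (rule set_integrable_bound[OF set_integrable_generator_bound[OF A, of C]])
    have [measurable]: "(\<lambda>s. generator c \<phi> s (f s)) \<in> borel_measurable borel"
      using f by (intro generator_measurable[OF \<phi>]) auto
    show "set_borel_measurable lborel A (\<lambda>s. generator c \<phi> s (f s))"
      unfolding set_borel_measurable_def using A by measurable
    show "AE s in lborel. s \<in> A \<longrightarrow> norm (generator c \<phi> s (f s)) \<le> norm (C * (norm (b s 0) + 1))"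
      using C by (auto intro: order_trans[OF C(2)])
  qed
qed

text \<open>Recognises the main term of \<open>one_step_expansion\<close> as a time integral of the
  generator with frozen state, since the inner product with a fixed vector commutes with
  integration.\<close>

lemma set_integral_generator:
  assumes \<phi>: "\<phi> \<in> test_functions" and r: "0 \<le> r" "r \<le> r'" "r' \<le> T"
  shows "(LINT s:{r..<r'}|lborel. generator c \<phi> s x)
    = gradient \<phi> x \<bullet> incr r r' x + (r' - r) * (c\<^sup>2 / 2 * laplacian \<phi> x)"
proof -
  have int: "set_integrable lborel {r..<r'} (\<lambda>s. b s x)"
    using r by (intro set_integrable_b[of "\<lambda>_. x" _ "norm x"]) auto
  then have 1: "set_integrable lborel {r..<r'} (\<lambda>s. gradient \<phi> x \<bullet> b s x)"
    and 2: "(LINT s:{r..<r'}|lborel. gradient \<phi> x \<bullet> b s x) = gradient \<phi> x \<bullet> incr r r' x"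
    unfolding set_integrable_def set_lebesgue_integral_def incr_def
    by (auto simp flip: inner_scaleR_right)
  show ?thesis
    unfolding generator_def
    by (subst set_integral_add) (use 1 2 r in \<open>auto simp: set_integral_const
       intro: set_integrable_lborel_const[of _ r r']\<close>)
qed

lemma abs_set_integral_generator_le:
  assumes "\<And>s x. \<bar>generator c \<phi> s x\<bar> \<le> C * (norm (b s 0) + 1)"
    and A: "A \<in> sets borel" "A \<subseteq> {0..T}"
    and int: "set_integrable lborel A (\<lambda>s. generator c \<phi> s (f s))"
  shows "\<bar>LINT s:A|lborel. generator c \<phi> s (f s)\<bar> \<le> (LINT s:A|lborel. C * (norm (b s 0) + 1))"
proof -
  have "\<bar>LINT s:A|lborel. generator c \<phi> s (f s)\<bar> \<le> (LINT s:A|lborel. \<bar>generator c \<phi> s (f s)\<bar>)"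
    using set_integral_norm_bound[OF int] by simp
  also have "\<dots> \<le> (LINT s:A|lborel. C * (norm (b s 0) + 1))"
    using set_integrable_norm[OF int] set_integrable_generator_bound[OF A] assms(1)
    by (intro set_integral_mono) auto
  finally show ?thesis .
qed

end

section \<open>The stochastic Euler scheme\<close>

context brownian_motion
begin

lemma filtration_measurable:
  assumes "f \<in> borel_measurable (F r)" "0 \<le> r" "r \<le> T"
  shows "f \<in> borel_measurable M"
  using measurable_from_subalg[OF filtration_subalgebra] assms by auto

text \<open>The freezing argument: the increment is independent of \<open>F r\<close>, hence of
  \<open>U\<close>, so their joint law is a product and Fubini integrates the increment out
  first.\<close>

lemma expectation_brownian_increment:
  fixes \<phi> :: "real ^ 'd \<Rightarrow> real"
  assumes U: "U \<in> borel_measurable (F r)" and r: "0 \<le> r" "r < r'" "r' \<le> T"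
    and [measurable]: "\<phi> \<in> borel_measurable borel" and B: "\<And>x. \<bar>\<phi> x\<bar> \<le> B"
  shows "expectation (\<lambda>\<omega>. \<phi> (U \<omega> + c *\<^sub>R (W r' \<omega> - W r \<omega>)))
    = expectation (\<lambda>\<omega>. \<integral>z. \<phi> (U \<omega> + c *\<^sub>R z) \<partial>gauss (r' - r))"
proof -
  define G where "G \<omega> = W r' \<omega> - W r \<omega>" for \<omega>
  have [measurable]: "U \<in> borel_measurable M"
    using r by (intro filtration_measurable[OF U]) auto
  have "W r \<in> borel_measurable M" "W r' \<in> borel_measurable M"
    using r by (auto intro!: filtration_measurable[OF BM_adapted])
  then have [measurable]: "G \<in> borel_measurable M"
    unfolding G_def by measurable
  have sub: "subalgebra M (F r)" using r by (intro filtration_subalgebra) auto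
  \<comment> \<open>Stability under intersection lets independence pass from the preimages of Borel
    sets to the sigma-algebras they generate, as \<open>indep_var\<close> requires.\<close>
  have st: "Int_stable {V -` A \<inter> space M |A. A \<in> sets borel}" for V :: "'a \<Rightarrow> real ^ 'd"
  proof (rule Int_stableI)
    fix P Q assume "P \<in> {V -` A \<inter> space M |A. A \<in> sets borel}" "Q \<in> {V -` A \<inter> space M |A. A \<in> sets borel}"
    then obtain A B where "A \<in> sets borel" "B \<in> sets borel" "P = V -` A \<inter> space M" "Q = V -` B \<inter> space M"
      by blast
    then have "A \<inter> B \<in> sets borel" "P \<inter> Q = V -` (A \<inter> B) \<inter> space M" by auto
    then show "P \<inter> Q \<in> {V -` A \<inter> space M |A. A \<in> sets borel}" by blast
  qed
  have "indep_set (sigma_sets (space M) {U -` A \<inter> space M |A. A \<in> sets borel})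
      (sigma_sets (space M) {G -` A \<inter> space M |A. A \<in> sets borel})"
  proof (rule indep_set_sigma_sets)
    have "{U -` A \<inter> space M |A. A \<in> sets borel} \<subseteq> sets (F r)"
      using measurable_sets[OF U] sub by (auto simp: subalgebra_def)
    moreover have "indep_set (sets (F r)) {G -` A \<inter> space M |A. A \<in> sets borel}"
      using BM_independent[OF r] by (simp add: G_def [abs_def])
    ultimately show "indep_set {U -` A \<inter> space M |A. A \<in> sets borel} {G -` A \<inter> space M |A. A \<in> sets borel}"
      unfolding indep_sets2_eq by blast
  qed (fact st)+
  then have "indep_var borel U borel G"
    by (simp add: indep_var_eq)
  then have joint: "distr M borel U \<Otimes>\<^sub>M distr M borel G = distr M (borel \<Otimes>\<^sub>M borel) (\<lambda>\<omega>. (U \<omega>, G \<omega>))"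
    by (simp add: indep_var_distribution_eq)
  \<comment> \<open>\<open>distributed\<close> is stated with \<open>lborel\<close> as target; only
    its sigma-algebra enters the image measure.\<close>
  have "distr M borel G = distr M lborel G" by (rule distr_cong) auto
  also have "\<dots> = gauss (r' - r)"
    using distributed_distr_eq_density[OF BM_gaussian[OF r]] by (simp add: gauss_def G_def [abs_def])
  finally have G: "distr M borel G = gauss (r' - r)" .
  interpret dU: prob_space "distr M borel U" by (rule prob_space_distr) simp
  interpret dG: prob_space "distr M borel G" by (rule prob_space_distr) simp
  interpret P: pair_prob_space "distr M borel U" "distr M borel G" ..
  let ?f = "\<lambda>(u, z). \<phi> (u + c *\<^sub>R z)"
  have int: "integrable (distr M borel U \<Otimes>\<^sub>M distr M borel G) ?f"
    by (rule P.P.integrable_const_bound[of _ B]) (use B in auto)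
  have "expectation (\<lambda>\<omega>. \<phi> (U \<omega> + c *\<^sub>R G \<omega>)) = integral\<^sup>L (distr M (borel \<Otimes>\<^sub>M borel) (\<lambda>\<omega>. (U \<omega>, G \<omega>))) ?f"
    by (subst integral_distr) auto
  also have "\<dots> = (\<integral>u. \<integral>z. \<phi> (u + c *\<^sub>R z) \<partial>distr M borel G \<partial>distr M borel U)"
    unfolding joint[symmetric] using P.integral_fst'[OF int] by simp
  also have "\<dots> = expectation (\<lambda>\<omega>. \<integral>z. \<phi> (U \<omega> + c *\<^sub>R z) \<partial>distr M borel G)"
    by (rule integral_distr) simp_all
  finally show ?thesis unfolding G by (simp add: G_def)
qed

end

locale euler_scheme = brownian_motion M F T W + lipschitz_drift b T L
  for M :: "'a measure" and F T and W :: "real \<Rightarrow> 'a \<Rightarrow> real ^ 'd"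
    and b :: "real \<Rightarrow> real ^ 'd \<Rightarrow> real ^ 'd" and L +
  fixes X0 :: "'a \<Rightarrow> real ^ 'd" and c :: real
  assumes X0_measurable: "X0 \<in> borel_measurable (F 0)" and c_nonneg: "c \<ge> 0"
begin

definition scheme :: "real \<Rightarrow> nat \<Rightarrow> 'a \<Rightarrow> real ^ 'd" where
  "scheme h k \<omega> = euler c h (\<lambda>t. W t \<omega>) (X0 \<omega>) k"

lemma scheme_0 [simp]: "scheme h 0 = X0"
  by (simp add: scheme_def fun_eq_iff)

lemma scheme_Suc: "scheme h (Suc k) \<omega> = scheme h k \<omega> + incr (real k * h) (real (Suc k) * h) (scheme h k \<omega>)
     + c *\<^sub>R (W (real (Suc k) * h) \<omega> - W (real k * h) \<omega>)"
  by (simp add: scheme_def)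

lemma scheme_adapted:
  assumes "h > 0"
  shows "real k * h \<le> T \<Longrightarrow> scheme h k \<in> borel_measurable (F (real k * h))"
proof (induction k)
  case 0
  then show ?case using X0_measurable by simp
next
  case (Suc k)
  have le: "real k * h \<le> real (Suc k) * h" using assms by (intro mult_right_mono) auto
  then have sub: "subalgebra (F (real (Suc k) * h)) (F (real k * h))"
    using assms Suc.prems by (intro filtration_mono) auto
  have [measurable]: "scheme h k \<in> borel_measurable (F (real (Suc k) * h))"
    by (rule measurable_from_subalg[OF sub Suc.IH]) (rule order_trans[OF le Suc.prems])
  have [measurable]: "W (real k * h) \<in> borel_measurable (F (real (Suc k) * h))"
    using order_trans[OF le Suc.prems] assms by (intro measurable_from_subalg[OF sub] BM_adapted) auto
  have [measurable]: "W (real (Suc k) * h) \<in> borel_measurable (F (real (Suc k) * h))"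
    using Suc.prems assms by (intro BM_adapted) auto
  show ?case unfolding scheme_Suc [abs_def] by measurable
qed

lemma scheme_measurable:
  assumes "h > 0" "real k * h \<le> T"
  shows "scheme h k \<in> borel_measurable M"
  using assms by (intro filtration_measurable[OF scheme_adapted]) auto

lemma integrable_set_integral_generator:
  assumes \<phi>: "\<phi> \<in> test_functions" and [measurable]: "V \<in> borel_measurable M"
    and r: "0 \<le> r" "r \<le> r'" "r' \<le> T"
  shows "integrable M (\<lambda>\<omega>. LINT s:{r..<r'}|lborel. generator c \<phi> s (V \<omega>))"
proof -
  let ?A = "\<lambda>\<omega>. LINT s:{r..<r'}|lborel. generator c \<phi> s (V \<omega>)"
  have [measurable]: "gradient \<phi> \<in> borel_measurable borel" "laplacian \<phi> \<in> borel_measurable borel"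
    using gradient_continuous[OF \<phi>] laplacian_continuous[OF \<phi>] by (auto intro: borel_measurable_continuous_onI)
  obtain C where C: "\<And>s x. \<bar>generator c \<phi> s x\<bar> \<le> C * (norm (b s 0) + 1)"
    using generator_bound[OF \<phi>] by blast
  show ?thesis
  proof (rule integrable_const_bound)
    show "AE \<omega> in M. norm (?A \<omega>) \<le> (LINT s:{r..<r'}|lborel. C * (norm (b s 0) + 1))"
      unfolding real_norm_def using r
      by (intro AE_I2 abs_set_integral_generator_le set_integrable_generator[OF \<phi>] C) auto
    show "?A \<in> borel_measurable M" unfolding set_integral_generator[OF \<phi> r] by measurable
  qed
qed

text \<open>Integrating out the noise leaves a function of the current state, to which the
  deterministic expansion applies. Since \<open>e\<close> does not depend on the state, the error
  bound passes through the expectation unchanged.\<close>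

lemma expectation_one_step:
  assumes \<phi>: "\<phi> \<in> test_functions" and V: "V \<in> borel_measurable (F r)" and r: "0 \<le> r" "r < r'" "r' \<le> T"
    and err: "\<And>x. \<bar>(\<integral>z. \<phi> (x + incr r r' x + c *\<^sub>R z) \<partial>gauss (r' - r)) - \<phi> x
        - (gradient \<phi> x \<bullet> incr r r' x + (r' - r) * (c\<^sup>2 / 2 * laplacian \<phi> x))\<bar> \<le> e"
  shows "\<bar>expectation (\<lambda>\<omega>. \<phi> (V \<omega> + incr r r' (V \<omega>) + c *\<^sub>R (W r' \<omega> - W r \<omega>))) - expectation (\<lambda>\<omega>. \<phi> (V \<omega>))
     - expectation (\<lambda>\<omega>. LINT s:{r..<r'}|lborel. generator c \<phi> s (V \<omega>))\<bar> \<le> e"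
proof -
  note [measurable] = test_function_measurable[OF \<phi>]
  have [measurable]: "V \<in> borel_measurable M" using r by (intro filtration_measurable[OF V]) auto
  have [measurable]: "(\<lambda>\<omega>. V \<omega> + incr r r' (V \<omega>)) \<in> borel_measurable (F r)"
    using V by measurable
  obtain B where B: "B \<ge> 0" "\<And>x. \<bar>\<phi> x\<bar> \<le> B" using test_function_bounded[OF \<phi>] by blast
  interpret G: prob_space "gauss (r' - r) :: (real ^ 'd) measure"
    using r by (intro prob_space_gauss) auto
  let ?A = "\<lambda>\<omega>. LINT s:{r..<r'}|lborel. generator c \<phi> s (V \<omega>)"
  let ?P = "\<lambda>\<omega>. \<integral>z. \<phi> (V \<omega> + incr r r' (V \<omega>) + c *\<^sub>R z) \<partial>gauss (r' - r)"
  have A_eq: "?A \<omega> = gradient \<phi> (V \<omega>) \<bullet> incr r r' (V \<omega>) + (r' - r) * (c\<^sup>2 / 2 * laplacian \<phi> (V \<omega>))" for \<omega>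
    using r by (intro set_integral_generator[OF \<phi>]) auto
  have A: "integrable M ?A"
    using r by (intro integrable_set_integral_generator[OF \<phi>]) auto
  have \<phi>V: "integrable M (\<lambda>\<omega>. \<phi> (V \<omega>))"
    by (rule integrable_const_bound[of _ B]) (use B in auto)
  have P: "integrable M ?P"
  proof (rule integrable_const_bound)
    show "AE \<omega> in M. norm (?P \<omega>) \<le> B"
    proof (intro AE_I2)
      fix \<omega>
      have "norm (?P \<omega>) \<le> (\<integral>z. norm (\<phi> (V \<omega> + incr r r' (V \<omega>) + c *\<^sub>R z)) \<partial>gauss (r' - r))"
        by (rule integral_norm_bound)
      also have "\<dots> \<le> B"
        using B by (intro G.integral_le_const G.integrable_const_bound[of _ B]) auto
      finally show "norm (?P \<omega>) \<le> B" .
    qed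
    show "?P \<in> borel_measurable M"
      by (intro G.borel_measurable_lebesgue_integral) measurable
  qed
  have "expectation (\<lambda>\<omega>. \<phi> (V \<omega> + incr r r' (V \<omega>) + c *\<^sub>R (W r' \<omega> - W r \<omega>))) = expectation ?P"
    by (rule expectation_brownian_increment[OF _ r _ B(2)]) measurable
  then have eq: "expectation (\<lambda>\<omega>. \<phi> (V \<omega> + incr r r' (V \<omega>) + c *\<^sub>R (W r' \<omega> - W r \<omega>)))
      - expectation (\<lambda>\<omega>. \<phi> (V \<omega>)) - expectation ?A = expectation (\<lambda>\<omega>. ?P \<omega> - \<phi> (V \<omega>) - ?A \<omega>)"
    using P \<phi>V A by simp
  have "\<bar>expectation (\<lambda>\<omega>. ?P \<omega> - \<phi> (V \<omega>) - ?A \<omega>)\<bar> \<le> expectation (\<lambda>\<omega>. \<bar>?P \<omega> - \<phi> (V \<omega>) - ?A \<omega>\<bar>)"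
    by (rule integral_abs_bound)
  also have "\<dots> \<le> e"
    using P \<phi>V A err by (intro integral_le_const) (auto simp: A_eq)
  finally show "\<bar>expectation (\<lambda>\<omega>. \<phi> (V \<omega> + incr r r' (V \<omega>) + c *\<^sub>R (W r' \<omega> - W r \<omega>))) - expectation (\<lambda>\<omega>. \<phi> (V \<omega>))
     - expectation ?A\<bar> \<le> e" unfolding eq .
qed

section \<open>Summing the one-step expansions\<close>

definition euler_integral :: "(real ^ 'd \<Rightarrow> real) \<Rightarrow> real \<Rightarrow> nat \<Rightarrow> 'a \<Rightarrow> real" where
  "euler_integral \<phi> h n \<omega> = (LINT s:{0..<real n * h}|lborel. generator c \<phi> s (scheme h (nat \<lfloor>s / h\<rfloor>) \<omega>))"

text \<open>The finite sum yields measurability in \<open>\<omega>\<close> and matches the one-step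
  estimates; the integral on which \<open>euler_integral\<close> is based is the form that passes to
  the limit.\<close>

lemma euler_integral_eq_sum:
  assumes \<phi>: "\<phi> \<in> test_functions" and h: "h > 0" "real n * h \<le> T"
  shows "euler_integral \<phi> h n =
      (\<lambda>\<omega>. \<Sum>k<n. LINT s:{real k * h..<real (Suc k) * h}|lborel. generator c \<phi> s (scheme h k \<omega>))"
    and "k < n \<Longrightarrow> integrable M (\<lambda>\<omega>. LINT s:{real k * h..<real (Suc k) * h}|lborel. generator c \<phi> s (scheme h k \<omega>))"
    and "euler_integral \<phi> h n \<in> borel_measurable M"
proof -
  have grid: "0 \<le> real k * h" "real k * h \<le> real (Suc k) * h" "real (Suc k) * h \<le> T" if "k < n" for k
  proof -
    have "real (Suc k) * h \<le> real n * h" using that h by (intro mult_right_mono) auto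
    with h(2) show "real (Suc k) * h \<le> T" by linarith
  qed (use h in \<open>auto simp: algebra_simps\<close>)
  show eq: "euler_integral \<phi> h n =
      (\<lambda>\<omega>. \<Sum>k<n. LINT s:{real k * h..<real (Suc k) * h}|lborel. generator c \<phi> s (scheme h k \<omega>))"
  proof
    fix \<omega>
    have "set_integrable lborel {real k * h..<real (Suc k) * h} (\<lambda>s. generator c \<phi> s (scheme h k \<omega>))" if "k < n" for k
    proof (rule set_integrable_generator[OF \<phi>])
      show "{real k * h..<real (Suc k) * h} \<subseteq> {0..T}"
      proof
        fix s assume "s \<in> {real k * h..<real (Suc k) * h}"
        then have "real k * h \<le> s" "s < real (Suc k) * h" by (simp_all only: atLeastLessThan_iff)
        then show "s \<in> {0..T}"
          using grid[OF that] unfolding atLeastAtMost_iff by linarith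
      qed
    qed auto
    from set_integral_grid[OF h(1) this, of n] show "euler_integral \<phi> h n \<omega> =
        (\<Sum>k<n. LINT s:{real k * h..<real (Suc k) * h}|lborel. generator c \<phi> s (scheme h k \<omega>))"
      unfolding euler_integral_def by blast
  qed
  show int: "integrable M (\<lambda>\<omega>. LINT s:{real k * h..<real (Suc k) * h}|lborel. generator c \<phi> s (scheme h k \<omega>))"
    if "k < n" for k
    using grid[OF that] by (intro integrable_set_integral_generator[OF \<phi>] scheme_measurable h(1)) linarith+
  show "euler_integral \<phi> h n \<in> borel_measurable M"
    unfolding eq using int by (intro borel_measurable_sum borel_measurable_integrable) auto
qed

text \<open>The one-step differences of \<open>expectation (\<lambda>\<omega>. \<phi> (scheme h k
  \<omega>))\<close> telescope, so the one-step errors simply add up.\<close>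

lemma euler_expansion:
  assumes \<phi>: "\<phi> \<in> test_functions" and h: "h > 0" "real n * h \<le> T"
    and err: "\<And>k x. k < n \<Longrightarrow> \<bar>(\<integral>z. \<phi> (x + incr (real k * h) (real (Suc k) * h) x + c *\<^sub>R z) \<partial>gauss h) - \<phi> x
        - (gradient \<phi> x \<bullet> incr (real k * h) (real (Suc k) * h) x + h * (c\<^sup>2 / 2 * laplacian \<phi> x))\<bar> \<le> e k"
  shows "\<bar>expectation (\<lambda>\<omega>. \<phi> (scheme h n \<omega>)) - expectation (\<lambda>\<omega>. \<phi> (X0 \<omega>)) - expectation (euler_integral \<phi> h n)\<bar>
      \<le> (\<Sum>k<n. e k)"
proof -
  define A where "A k \<omega> = (LINT s:{real k * h..<real (Suc k) * h}|lborel. generator c \<phi> s (scheme h k \<omega>))" for k \<omega>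
  have step: "\<bar>expectation (\<lambda>\<omega>. \<phi> (scheme h (Suc k) \<omega>)) - expectation (\<lambda>\<omega>. \<phi> (scheme h k \<omega>)) - expectation (A k)\<bar> \<le> e k"
    if k: "k < n" for k
  proof -
    have "real (Suc k) * h \<le> real n * h" using k h by (intro mult_right_mono) auto
    then have grid: "real (Suc k) * h \<le> T" using h(2) by linarith
    have grid': "0 \<le> real k * h" "real k * h < real (Suc k) * h" "real (Suc k) * h - real k * h = h"
      using h by (auto simp: algebra_simps)
    have V: "scheme h k \<in> borel_measurable (F (real k * h))"
      using grid grid' by (intro scheme_adapted h(1)) linarith
    show ?thesis
      using expectation_one_step[OF \<phi> V grid'(1,2) grid, unfolded grid'(3), OF err[OF k]]
      by (simp only: scheme_Suc A_def [abs_def])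
  qed
  have "expectation (euler_integral \<phi> h n) = (\<Sum>k<n. expectation (A k))"
    unfolding euler_integral_eq_sum(1)[OF \<phi> h] A_def [abs_def]
    by (intro Bochner_Integration.integral_sum euler_integral_eq_sum(2)[OF \<phi> h]) simp
  moreover have "(\<Sum>k<n. expectation (\<lambda>\<omega>. \<phi> (scheme h (Suc k) \<omega>)) - expectation (\<lambda>\<omega>. \<phi> (scheme h k \<omega>)))
      = expectation (\<lambda>\<omega>. \<phi> (scheme h n \<omega>)) - expectation (\<lambda>\<omega>. \<phi> (X0 \<omega>))"
    by (subst sum_lessThan_telescope) simp
  ultimately have eq: "expectation (\<lambda>\<omega>. \<phi> (scheme h n \<omega>)) - expectation (\<lambda>\<omega>. \<phi> (X0 \<omega>)) - expectation (euler_integral \<phi> h n)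
     = (\<Sum>k<n. expectation (\<lambda>\<omega>. \<phi> (scheme h (Suc k) \<omega>)) - expectation (\<lambda>\<omega>. \<phi> (scheme h k \<omega>)) - expectation (A k))"
    by (simp add: sum_subtractf)
  show "\<bar>expectation (\<lambda>\<omega>. \<phi> (scheme h n \<omega>)) - expectation (\<lambda>\<omega>. \<phi> (X0 \<omega>)) - expectation (euler_integral \<phi> h n)\<bar>
      \<le> (\<Sum>k<n. e k)"
    unfolding eq using step by (intro order_trans[OF sum_abs] sum_mono) auto
qed

text \<open>Each one-step error is a product of two factors of cell size plus
  \<open>h * sqrt h\<close>. For small steps one factor is at most \<open>\<eta>\<close> while the
  other sums to the fixed number \<open>S\<close>, and the remaining terms sum to
  \<open>t * sqrt h\<close>. In the limit the defect is at most \<open>C * (\<eta> * S)\<close> for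
  every positive \<open>\<eta>\<close>.\<close>

lemma weak_identity_defect:
  assumes \<phi>: "\<phi> \<in> test_functions" and t: "0 < t" "t \<le> T"
    and \<Delta>: "(\<lambda>n. expectation (\<lambda>\<omega>. \<phi> (scheme (t / real (Suc n)) (Suc n) \<omega>)) - expectation (\<lambda>\<omega>. \<phi> (X0 \<omega>))
        - expectation (euler_integral \<phi> (t / real (Suc n)) (Suc n))) \<longlonglongrightarrow> \<Delta>"
  shows "\<Delta> = 0"
proof -
  obtain C K h0 where CK: "C \<ge> 0" "K \<ge> 0" "h0 > 0"
    and err: "\<And>r r' x. 0 \<le> r \<Longrightarrow> r < r' \<Longrightarrow> r' \<le> T \<Longrightarrow> r' - r < h0 \<Longrightarrow>
      \<bar>(\<integral>z. \<phi> (x + incr r r' x + c *\<^sub>R z) \<partial>gauss (r' - r)) - \<phi> x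
        - (gradient \<phi> x \<bullet> incr r r' x + (r' - r) * (c\<^sup>2 / 2 * laplacian \<phi> x))\<bar>
      \<le> C * ((mass r r' + K * (r' - r)) * (mass r r' + K * (r' - r) + (r' - r))
          + (r' - r) * sqrt (r' - r))"
    using one_step_expansion[OF \<phi> c_nonneg] by blast
  define S where "S = mass 0 t + K * t"
  \<comment> \<open>Counting cells by \<open>Suc n\<close> keeps every step length positive.\<close>
  define h where "h n = t / real (Suc n)" for n
  have h0': "h \<longlonglongrightarrow> 0" unfolding h_def by (rule LIMSEQ_Suc[OF lim_const_over_n])
  have h: "h n > 0" "real (Suc n) * h n = t" for n using t by (auto simp: h_def)
  have S: "S \<ge> 0" using mass_nonneg CK t by (simp add: S_def)
  have bound: "\<bar>\<Delta>\<bar> \<le> C * (\<eta> * S)" if \<eta>: "\<eta> > 0" for \<eta>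
  proof -
    obtain h1 where h1: "h1 > 0"
      "\<And>r r'. 0 \<le> r \<Longrightarrow> r \<le> r' \<Longrightarrow> r' \<le> T \<Longrightarrow> r' - r < h1 \<Longrightarrow> mass r r' < \<eta> / 2"
      using mass_uniformly_small[of "\<eta> / 2"] \<eta> by auto
    \<comment> \<open>The three thresholds validate the one-step estimate, bring the mass of a cell
      below \<open>\<eta> / 2\<close>, and give
      \<open>(K + 1) * h n \<le> \<eta> / 2\<close>.\<close>
    define h2 where "h2 = min (min h0 h1) (\<eta> / (2 * (K + 1)))"
    have "h2 > 0" using h1 CK \<eta> by (simp add: h2_def)
    then have ev: "eventually (\<lambda>n. h n < h2) sequentially"
      using order_tendstoD(2)[OF h0'] by blast
    let ?D = "\<lambda>n. expectation (\<lambda>\<omega>. \<phi> (scheme (t / real (Suc n)) (Suc n) \<omega>)) - expectation (\<lambda>\<omega>. \<phi> (X0 \<omega>))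
        - expectation (euler_integral \<phi> (t / real (Suc n)) (Suc n))"
    have le: "\<bar>?D n\<bar> \<le> C * (\<eta> * S + t * sqrt (h n))" if n: "h n < h2" for n
    proof -
      let ?r = "\<lambda>k. real k * h n"
      define m where "m k = mass (?r k) (?r (Suc k))" for k
      have Kh: "(K + 1) * h n \<le> \<eta> / 2"
      proof -
        have "h n \<le> \<eta> / (2 * (K + 1))" using n by (simp add: h2_def)
        then have "h n * (2 * (K + 1)) \<le> \<eta>" using CK by (simp add: pos_le_divide_eq)
        then show ?thesis by (simp add: algebra_simps)
      qed
      have diff: "?r (Suc k) - ?r k = h n" and r0: "0 \<le> ?r k" and rless: "?r k < ?r (Suc k)" for k
        using h(1)[of n] by (auto simp: algebra_simps)
      have rT: "?r (Suc k) \<le> T" if "k < Suc n" for k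
      proof -
        have "?r (Suc k) \<le> real (Suc n) * h n" using that h(1)[of n] by (intro mult_right_mono) auto
        then show ?thesis using h(2)[of n] t(2) by linarith
      qed
      have m: "0 \<le> m k" "m k + K * h n + h n \<le> \<eta>" if "k < Suc n" for k
      proof -
        show "0 \<le> m k" by (simp only: m_def mass_nonneg)
        have "m k < \<eta> / 2"
          unfolding m_def using n rT[OF that] rless[of k] diff[of k] r0[of k]
          by (intro h1(2)) (auto simp: h2_def)
        then show "m k + K * h n + h n \<le> \<eta>" using Kh by (simp add: algebra_simps)
      qed
      have msum: "(\<Sum>k<Suc n. m k) = mass 0 t"
      proof -
        have "set_integrable lborel {?r k..<?r (Suc k)} (\<lambda>s. norm (b s 0))" if "k < Suc n" for k
          by (rule set_integrable_norm_b[OF r0 rT[OF that]])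
        then have "(LINT s:{0..<real (Suc n) * h n}|lborel. norm (b s 0)) = (\<Sum>k<Suc n. m k)"
          unfolding m_def mass_def
          using set_integral_grid[OF h(1)[of n], of "Suc n" "\<lambda>_ s. norm (b s 0)"] by blast
        then show ?thesis by (simp only: mass_def h(2))
      qed
      have "\<bar>?D n\<bar> \<le> (\<Sum>k<Suc n. C * ((m k + K * h n) * (m k + K * h n + h n) + h n * sqrt (h n)))"
        unfolding h_def[symmetric]
      proof (rule euler_expansion[OF \<phi>])
        show "real (Suc n) * h n \<le> T" using h(2)[of n] t(2) by linarith
        fix k x assume "k < Suc n"
        then show "\<bar>(\<integral>z. \<phi> (x + incr (?r k) (?r (Suc k)) x + c *\<^sub>R z) \<partial>gauss (h n)) - \<phi> x
          - (gradient \<phi> x \<bullet> incr (?r k) (?r (Suc k)) x + h n * (c\<^sup>2 / 2 * laplacian \<phi> x))\<bar>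
          \<le> C * ((m k + K * h n) * (m k + K * h n + h n) + h n * sqrt (h n))"
          using err[OF r0 rless rT, unfolded diff, of k x] n unfolding m_def by (simp add: h2_def)
      qed (rule h)
      \<comment> \<open>Only the second factor is replaced by \<open>\<eta>\<close>; the first is
        kept because its sum over the cells does not depend on \<open>n\<close>.\<close>
      also have "\<dots> \<le> (\<Sum>k<Suc n. C * ((m k + K * h n) * \<eta> + h n * sqrt (h n)))"
        using m CK h(1)[of n] by (intro sum_mono mult_left_mono add_right_mono) auto
      also have "\<dots> = C * (((\<Sum>k<Suc n. m k) + K * (real (Suc n) * h n)) * \<eta> + (real (Suc n) * h n) * sqrt (h n))"
        by (simp only: sum_distrib_left[symmetric] sum_distrib_right[symmetric] sum.distrib sum_constant card_lessThan mult_ac)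
      also have "\<dots> = C * (\<eta> * S + t * sqrt (h n))"
        unfolding msum h(2) S_def by (simp add: mult.commute)
      finally show ?thesis .
    qed
    have "(\<lambda>n. \<bar>?D n\<bar>) \<longlonglongrightarrow> \<bar>\<Delta>\<bar>" using \<Delta> by (rule tendsto_rabs)
    moreover have "(\<lambda>n. C * (\<eta> * S + t * sqrt (h n))) \<longlonglongrightarrow> C * (\<eta> * S + t * sqrt 0)"
      by (intro tendsto_intros h0')
    ultimately have "\<bar>\<Delta>\<bar> \<le> C * (\<eta> * S + t * sqrt 0)"
      using eventually_mono[OF ev le] by (intro tendsto_le[OF sequentially_bot]) auto
    then show ?thesis by simp
  qed
  show ?thesis
  proof (rule ccontr)
    assume "\<Delta> \<noteq> 0"
    \<comment> \<open>With this value of \<open>\<eta>\<close> the bound yields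
      \<open>\<bar>\<Delta>\<bar> \<le> \<bar>\<Delta>\<bar> / 2\<close>; the added 1 covers
      \<open>C * S = 0\<close>.\<close>
    then have "\<bar>\<Delta>\<bar> / (2 * (C * S + 1)) > 0" using CK S by (intro divide_pos_pos) (auto intro: add_nonneg_pos)
    from bound[OF this] have "\<bar>\<Delta>\<bar> \<le> \<bar>\<Delta>\<bar> * (C * S / (2 * (C * S + 1)))" by (simp add: mult_ac)
    also have "\<dots> \<le> \<bar>\<Delta>\<bar> * (1 / 2)"
    proof (intro mult_left_mono)
      have "C * S \<ge> 0" using CK S by simp
      then show "C * S / (2 * (C * S + 1)) \<le> 1 / 2" by (simp add: divide_simps)
    qed simp
    finally show False using \<open>\<Delta> \<noteq> 0\<close> by simp
  qed
qed

text \<open>The limit in \<open>euler_expansion\<close> is taken in two stages: first in the time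
  integral along almost every path, with majorant \<open>w\<close>, then in the expectation, with
  the constant \<open>integral\<^sup>L lborel w\<close> as majorant. Fubini finally exchanges
  expectation and time integral.\<close>

theorem expectation_weak_identity:
  assumes Z: "(\<lambda>(s, \<omega>). Z s \<omega>) \<in> borel_measurable (borel \<Otimes>\<^sub>M M)"
    and sol: "AE \<omega> in M. Z 0 \<omega> = X0 \<omega> \<and> integral_solution c (\<lambda>t. W t \<omega>) (\<lambda>s. Z s \<omega>)"
    and \<phi>: "\<phi> \<in> test_functions" and t: "0 \<le> t" "t \<le> T"
  shows "set_integrable lborel {0..<t} (\<lambda>s. expectation (\<lambda>\<omega>. generator c \<phi> s (Z s \<omega>)))"
    and "expectation (\<lambda>\<omega>. \<phi> (Z t \<omega>)) = expectation (\<lambda>\<omega>. \<phi> (Z 0 \<omega>))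
      + (LINT s:{0..<t}|lborel. expectation (\<lambda>\<omega>. generator c \<phi> s (Z s \<omega>)))"
proof -
  note [measurable] = test_function_measurable[OF \<phi>]
  have Zm: "Z s \<in> borel_measurable M" for s
    using measurable_compose[OF measurable_Pair1' Z, of s] by simp
  have X0m [measurable]: "X0 \<in> borel_measurable M"
    using X0_measurable T_pos by (intro filtration_measurable) auto
  obtain B where B: "B \<ge> 0" "\<And>x. \<bar>\<phi> x\<bar> \<le> B" using test_function_bounded[OF \<phi>] by blast
  obtain C where C: "C \<ge> 0" "\<And>s x. \<bar>generator c \<phi> s x\<bar> \<le> C * (norm (b s 0) + 1)"
    using generator_bound[OF \<phi>] by blast
  have sub: "{0..<t} \<subseteq> {0..T}" using t by auto
  define w where "w s = indicator {0..<t} s *\<^sub>R (C * (norm (b s 0) + 1))" for s :: real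
  have w: "integrable lborel w"
    using set_integrable_generator_bound[OF _ sub, of C] by (simp add: set_integrable_def w_def [abs_def])
  have g_le: "norm (indicator {0..<t} s *\<^sub>R generator c \<phi> s x) \<le> w s" for s x
    using C(2)[of s x] by (simp add: w_def split: split_indicator)
  have w_nonneg: "w s \<ge> 0" for s using C(1) by (simp add: w_def split: split_indicator)
  have gm: "(\<lambda>(s, \<omega>). indicator {0..<t} s *\<^sub>R generator c \<phi> s (Z s \<omega>)) \<in> borel_measurable (lborel \<Otimes>\<^sub>M M)"
  proof -
    have [measurable]: "(\<lambda>p. generator c \<phi> (fst p) (Z (fst p) (snd p))) \<in> borel_measurable (lborel \<Otimes>\<^sub>M M)"
      by (rule generator_measurable[OF \<phi>]) (use Z in \<open>auto simp: case_prod_beta' cong: measurable_cong_sets\<close>)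
    show ?thesis unfolding case_prod_beta' by measurable
  qed
  have gs: "integrable M (\<lambda>\<omega>. indicator {0..<t} s *\<^sub>R generator c \<phi> s (Z s \<omega>))" for s
    by (rule integrable_const_bound[of _ "w s"])
      (use g_le measurable_compose[OF measurable_Pair1' gm, of s] in auto)
  interpret P: pair_sigma_finite lborel M ..
  have prod: "integrable (lborel \<Otimes>\<^sub>M M) (\<lambda>(s, \<omega>). indicator {0..<t} s *\<^sub>R generator c \<phi> s (Z s \<omega>))"
  proof (rule P.Fubini_integrable[OF gm])
    show "integrable lborel (\<lambda>s. \<integral>\<omega>. norm (case (s, \<omega>) of (s, \<omega>) \<Rightarrow> indicator {0..<t} s *\<^sub>R generator c \<phi> s (Z s \<omega>)) \<partial>M)"
    proof (rule Bochner_Integration.integrable_bound[OF w])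
      have "(\<lambda>s. \<integral>\<omega>. norm (indicator {0..<t} s *\<^sub>R generator c \<phi> s (Z s \<omega>)) \<partial>M) \<in> borel_measurable lborel"
        using measurable_compose[OF gm borel_measurable_norm]
        by (intro borel_measurable_lebesgue_integral) (simp add: case_prod_beta')
      then show "(\<lambda>s. \<integral>\<omega>. norm (case (s, \<omega>) of (s, \<omega>) \<Rightarrow> indicator {0..<t} s *\<^sub>R generator c \<phi> s (Z s \<omega>)) \<partial>M) \<in> borel_measurable lborel"
        by simp
      have "(\<integral>\<omega>. norm (indicator {0..<t} s *\<^sub>R generator c \<phi> s (Z s \<omega>)) \<partial>M) \<le> w s" for s
        using gs[of s] g_le by (intro integral_le_const integrable_norm AE_I2)
      then show "AE s in lborel. norm (\<integral>\<omega>. norm (case (s, \<omega>) of (s, \<omega>) \<Rightarrow> indicator {0..<t} s *\<^sub>R generator c \<phi> s (Z s \<omega>)) \<partial>M) \<le> norm (w s)"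
        using w_nonneg by (simp add: integral_nonneg_AE)
    qed
    show "AE s in lborel. integrable M (\<lambda>\<omega>. case (s, \<omega>) of (s, \<omega>) \<Rightarrow> indicator {0..<t} s *\<^sub>R generator c \<phi> s (Z s \<omega>))"
      using gs by simp
  qed
  show "set_integrable lborel {0..<t} (\<lambda>s. expectation (\<lambda>\<omega>. generator c \<phi> s (Z s \<omega>)))"
    using P.integrable_fst'[OF prod] by (simp add: set_integrable_def)
  define I where "I \<omega> = (LINT s:{0..<t}|lborel. generator c \<phi> s (Z s \<omega>))" for \<omega>
  have EI: "expectation I = (LINT s:{0..<t}|lborel. expectation (\<lambda>\<omega>. generator c \<phi> s (Z s \<omega>)))"
    using P.Fubini_integral[OF prod] by (simp add: I_def [abs_def] set_lebesgue_integral_def)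
  have Im: "I \<in> borel_measurable M"
    using borel_measurable_integrable[OF P.integrable_snd[OF prod]] by (simp add: I_def [abs_def] set_lebesgue_integral_def)
  show "expectation (\<lambda>\<omega>. \<phi> (Z t \<omega>)) = expectation (\<lambda>\<omega>. \<phi> (Z 0 \<omega>))
      + (LINT s:{0..<t}|lborel. expectation (\<lambda>\<omega>. generator c \<phi> s (Z s \<omega>)))"
  proof (cases "t = 0")
    case True
    then show ?thesis by (simp add: set_lebesgue_integral_def)
  next
    case False
    then have t': "0 < t" "t \<le> T" using t by auto
    define h where "h n = t / real (Suc n)" for n
    have h: "h n > 0" "real (Suc n) * h n = t" for n using t' by (auto simp: h_def)
    have scheme_m: "scheme (h n) k \<in> borel_measurable M" if "k \<le> Suc n" for n k
    proof (rule scheme_measurable[OF h(1)])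
      have "real k * h n \<le> real (Suc n) * h n" using that h(1)[of n] by (intro mult_right_mono) auto
      then show "real k * h n \<le> T" using h(2)[of n] t'(2) by linarith
    qed
    have conv: "AE \<omega> in M. \<forall>s\<in>{0..t}. (\<lambda>n. scheme (h n) (nat \<lfloor>s / h n\<rfloor>) \<omega>) \<longlonglongrightarrow> Z s \<omega>"
      using sol
    proof eventually_elim
      case (elim \<omega>)
      show ?case
      proof
        fix s assume "s \<in> {0..t}"
        then have "(\<lambda>n. euler c (t / real n) (\<lambda>t. W t \<omega>) (Z 0 \<omega>) (nat \<lfloor>s / (t / real n)\<rfloor>)) \<longlonglongrightarrow> Z s \<omega>"
          using elim t' by (intro euler_tendsto) auto
        from LIMSEQ_Suc[OF this] show "(\<lambda>n. scheme (h n) (nat \<lfloor>s / h n\<rfloor>) \<omega>) \<longlonglongrightarrow> Z s \<omega>"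
          using elim by (simp add: scheme_def h_def)
      qed
    qed
    \<comment> \<open>At \<open>s = t\<close> the floor returns the last node itself, so the
      pathwise convergence at time \<open>t\<close> concerns exactly the terminal value in
      \<open>euler_expansion\<close>.\<close>
    have end_idx: "nat \<lfloor>t / h n\<rfloor> = Suc n" for n
    proof -
      have "t / h n = real (Suc n)" using t' by (simp add: h_def)
      then show ?thesis by (simp only: floor_of_nat nat_int)
    qed
    have lim1: "(\<lambda>n. expectation (\<lambda>\<omega>. \<phi> (scheme (h n) (Suc n) \<omega>))) \<longlonglongrightarrow> expectation (\<lambda>\<omega>. \<phi> (Z t \<omega>))"
    proof (rule integral_dominated_convergence[of _ _ _ "\<lambda>_. B"])
      show "AE \<omega> in M. (\<lambda>n. \<phi> (scheme (h n) (Suc n) \<omega>)) \<longlonglongrightarrow> \<phi> (Z t \<omega>)"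
        using conv
      proof eventually_elim
        case (elim \<omega>)
        then have "(\<lambda>n. scheme (h n) (nat \<lfloor>t / h n\<rfloor>) \<omega>) \<longlonglongrightarrow> Z t \<omega>" using t' by auto
        then show ?case
          unfolding end_idx by (rule continuous_on_tendsto_compose[OF test_function_continuous[OF \<phi>]]) auto
      qed
      show "(\<lambda>\<omega>. \<phi> (scheme (h n) (Suc n) \<omega>)) \<in> borel_measurable M" for n
        using scheme_m[of "Suc n" n] by measurable
    qed (use B Zm in auto)
    \<comment> \<open>The scheme depends on \<open>s\<close> only through a natural number, so it is
      a Borel function of time for each fixed \<open>\<omega>\<close>, whatever the path of
      \<open>W\<close>.\<close>
    have step: "(\<lambda>s. scheme (h n) (nat \<lfloor>s / h n\<rfloor>) \<omega>) \<in> borel_measurable borel" for n \<omega>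
      by (rule measurable_compose[where f="\<lambda>s. nat \<lfloor>s / h n\<rfloor>" and N="count_space UNIV"
            and g="\<lambda>k. scheme (h n) k \<omega>"]) simp_all
    have lim2: "AE \<omega> in M. (\<lambda>n. euler_integral \<phi> (h n) (Suc n) \<omega>) \<longlonglongrightarrow> I \<omega>"
      using conv AE_space
    proof eventually_elim
      case (elim \<omega>)
      show ?case
        unfolding euler_integral_def I_def h(2) set_lebesgue_integral_def
      proof (rule integral_dominated_convergence[OF _ _ w])
        have "(\<lambda>s. Z s \<omega>) \<in> borel_measurable borel"
          using measurable_compose[OF measurable_Pair2' Z] elim by simp
        then have [measurable]: "(\<lambda>s. generator c \<phi> s (Z s \<omega>)) \<in> borel_measurable borel"
          by (intro generator_measurable[OF \<phi>]) auto
        show "(\<lambda>s. indicat_real {0..<t} s *\<^sub>R generator c \<phi> s (Z s \<omega>)) \<in> borel_measurable lborel" by measurable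
        have [measurable]: "(\<lambda>s. generator c \<phi> s (scheme (h n) (nat \<lfloor>s / h n\<rfloor>) \<omega>)) \<in> borel_measurable borel" for n
          using step by (intro generator_measurable[OF \<phi>]) auto
        show "(\<lambda>s. indicat_real {0..<t} s *\<^sub>R generator c \<phi> s (scheme (h n) (nat \<lfloor>s / h n\<rfloor>) \<omega>)) \<in> borel_measurable lborel" for n
          by measurable
        have "(\<lambda>n. generator c \<phi> s (scheme (h n) (nat \<lfloor>s / h n\<rfloor>) \<omega>)) \<longlonglongrightarrow> generator c \<phi> s (Z s \<omega>)" if "s \<in> {0..<t}" for s
          using elim(1) that by (intro continuous_on_tendsto_compose[OF generator_continuous[OF \<phi>]]) auto
        then show "AE s in lborel. (\<lambda>n. indicat_real {0..<t} s *\<^sub>R generator c \<phi> s (scheme (h n) (nat \<lfloor>s / h n\<rfloor>) \<omega>))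
            \<longlonglongrightarrow> indicat_real {0..<t} s *\<^sub>R generator c \<phi> s (Z s \<omega>)"
          by (intro AE_I2) (auto split: split_indicator)
      qed (intro AE_I2 g_le)
    qed
    have euler_m: "euler_integral \<phi> (h n) (Suc n) \<in> borel_measurable M" for n
      by (rule euler_integral_eq_sum(3)[OF \<phi> h(1)]) (use h(2)[of n] t'(2) in linarith)
    have lim3: "(\<lambda>n. expectation (euler_integral \<phi> (h n) (Suc n))) \<longlonglongrightarrow> expectation I"
    proof (rule integral_dominated_convergence[OF Im euler_m _ lim2])
      show "integrable M (\<lambda>_. integral\<^sup>L lborel w)" by simp
      show "AE \<omega> in M. norm (euler_integral \<phi> (h n) (Suc n) \<omega>) \<le> integral\<^sup>L lborel w" for n
        unfolding euler_integral_def h(2) w_def [abs_def] real_norm_def set_lebesgue_integral_def[symmetric]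
        by (intro AE_I2 abs_set_integral_generator_le C sub set_integrable_generator[OF \<phi>] step) auto
    qed
    have "expectation (\<lambda>\<omega>. \<phi> (X0 \<omega>)) = expectation (\<lambda>\<omega>. \<phi> (Z 0 \<omega>))"
      by (rule integral_cong_AE) (use sol Zm in auto)
    moreover have "expectation (\<lambda>\<omega>. \<phi> (Z t \<omega>)) - expectation (\<lambda>\<omega>. \<phi> (X0 \<omega>)) - expectation I = 0"
      by (rule weak_identity_defect[OF \<phi> t']) (intro tendsto_diff tendsto_const lim1[unfolded h_def] lim3[unfolded h_def])
    ultimately show ?thesis using EI by simp
  qed
qed

end

section \<open>Path laws and the frozen drift\<close>

lemma path_spaceD:
  assumes "f \<in> space (path_space T)"
  shows "continuous_on {0..T} f" "f \<in> extensional {0..T}"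
  using assms by (auto simp: path_space_def path_metric_def space_measure_of_conv
      continuous_map_iff_continuous)

text \<open>Evaluation at a time in \<open>[0,T]\<close> does not increase the uniform distance, so
  preimages of open sets are open. At other times every path takes the value
  \<open>undefined\<close>, and evaluation is constant.\<close>

lemma path_space_eval_measurable:
  "(\<lambda>f. f t) \<in> borel_measurable (path_space T :: (real \<Rightarrow> real ^ 'd) measure)"
proof (cases "t \<in> {0..T}")
  case True
  let ?m = "path_metric T :: (real \<Rightarrow> real ^ 'd) metric"
  have sp: "space (path_space T) = mspace ?m"
    by (simp add: path_space_def space_measure_of_conv)
  have opens: "V \<in> sets (path_space T)" if "openin (mtopology_of ?m) V" for V
  proof -
    have "{U. openin (mtopology_of ?m) U} \<subseteq> Pow (mspace ?m)"
      using openin_subset[of "mtopology_of ?m"] by auto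
    then show ?thesis unfolding path_space_def using that by (auto simp: sets_measure_of)
  qed
  show ?thesis
  proof (rule borel_measurableI)
    fix U :: "(real ^ 'd) set" assume U: "open U"
    interpret m: Metric_space "mspace ?m" "mdist ?m" by (rule Metric_space_mspace_mdist)
    have "openin m.mtopology ((\<lambda>f. f t) -` U \<inter> mspace ?m)"
      unfolding m.openin_mtopology
    proof (intro conjI allI impI)
      fix f assume f: "f \<in> (\<lambda>f. f t) -` U \<inter> mspace ?m"
      then obtain e where e: "e > 0" "ball (f t) e \<subseteq> U"
        using U openE[of U "f t"] by auto
      have "g t \<in> U" if g: "g \<in> m.mball f e" for g
      proof -
        have "f \<in> mspace ?m" "g \<in> mspace ?m" "mdist ?m f g < e"
          using g by (simp_all only: m.in_mball)
        then have "mdist euclidean_metric (f t) (g t) < e"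
          unfolding path_metric_def using True
          by (intro cfunspace_mdist_lt[of "top_of_set {0..T}" f euclidean_metric g e t])
            (auto simp: compactin_subtopology)
        then show ?thesis using e by auto
      qed
      then show "\<exists>r>0. m.mball f r \<subseteq> (\<lambda>f. f t) -` U \<inter> mspace ?m"
        using e(1) by (intro exI[of _ e]) auto
    qed auto
    then show "(\<lambda>f. f t) -` U \<inter> space (path_space T) \<in> sets (path_space T)"
      unfolding sp by (intro opens) (simp add: mtopology_of_def)
  qed
next
  case False
  have "f t = undefined" if "f \<in> space (path_space T)" for f :: "real \<Rightarrow> real ^ 'd"
    using path_spaceD(2)[OF that] False by (auto simp: extensional_def)
  then show ?thesis
    by (subst measurable_cong[where g="\<lambda>_. undefined"]) auto
qed

lemma ev_law_path_law:
  assumes "X \<in> measurable M (path_space T)"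
  shows "ev_law (path_law M T X) = (\<lambda>t. distr M borel (\<lambda>\<omega>. X \<omega> t))"
  unfolding ev_law_def path_law_def
  by (simp add: distr_distr[OF path_space_eval_measurable assms] comp_def)

text \<open>Rounding time down to a grid of mesh \<open>1 / Suc n\<close> gives functions with
  countably many time values, measurable by gluing; continuity in time makes them converge
  pointwise.\<close>

lemma borel_measurable_pair_continuous:
  fixes f :: "real \<Rightarrow> 'a \<Rightarrow> 'b::metric_space"
  assumes meas: "\<And>s. f s \<in> borel_measurable M"
    and cont: "\<And>\<omega>. \<omega> \<in> space M \<Longrightarrow> continuous_on UNIV (\<lambda>s. f s \<omega>)"
  shows "(\<lambda>(s, \<omega>). f s \<omega>) \<in> borel_measurable (borel \<Otimes>\<^sub>M M)"
proof (rule borel_measurable_LIMSEQ_metric)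
  define \<kappa> where "\<kappa> n s = real_of_int \<lfloor>s * real (Suc n)\<rfloor> / real (Suc n)" for n s
  show "(\<lambda>p. f (\<kappa> n (fst p)) (snd p)) \<in> borel_measurable (borel \<Otimes>\<^sub>M M)" for n
    unfolding \<kappa>_def
    by (rule measurable_compose_countable[where f="\<lambda>i p. f (real_of_int i / real (Suc n)) (snd p)"
          and g="\<lambda>p. \<lfloor>fst p * real (Suc n)\<rfloor>"]) (use meas in measurable)
  fix p :: "real \<times> 'a" assume p: "p \<in> space (borel \<Otimes>\<^sub>M M)"
  have \<kappa>: "(\<lambda>n. \<kappa> n s) \<longlonglongrightarrow> s" for s
  proof (rule tendsto_sandwich)
    show "eventually (\<lambda>n. s - 1 / real (Suc n) \<le> \<kappa> n s) sequentially"
    proof (intro always_eventually allI)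
      fix n
      have "s * real (Suc n) - 1 \<le> real_of_int \<lfloor>s * real (Suc n)\<rfloor>" by linarith
      then have "(s * real (Suc n) - 1) / real (Suc n) \<le> \<kappa> n s"
        unfolding \<kappa>_def by (intro divide_right_mono) auto
      then show "s - 1 / real (Suc n) \<le> \<kappa> n s" by (simp add: diff_divide_distrib)
    qed
    show "eventually (\<lambda>n. \<kappa> n s \<le> s) sequentially"
      by (intro always_eventually allI) (simp add: \<kappa>_def pos_divide_le_eq)
    show "(\<lambda>n. s - 1 / real (Suc n)) \<longlonglongrightarrow> s"
      using tendsto_diff[OF tendsto_const LIMSEQ_Suc[OF lim_const_over_n[of 1]], of s] by simp
  qed simp
  have "(\<lambda>n. f (\<kappa> n (fst p)) (snd p)) \<longlonglongrightarrow> f (fst p) (snd p)"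
    using p by (intro continuous_on_tendsto_compose[OF cont \<kappa>]) (auto simp: space_pair_measure)
  then show "(\<lambda>n. f (\<kappa> n (fst p)) (snd p)) \<longlonglongrightarrow> (case p of (s, \<omega>) \<Rightarrow> f s \<omega>)"
    by (simp add: case_prod_beta')
qed

lemma lipschitz_on_UNIV_norm:
  assumes "L-lipschitz_on UNIV H"
  shows "norm (H x - H y) \<le> L * norm (x - y)"
  using lipschitz_onD[OF assms, of x y] by (simp add: dist_norm)

lemma W1_space_integrable_lipschitz:
  fixes H :: "'v::euclidean_space \<Rightarrow> 'v"
  assumes H: "L-lipschitz_on UNIV H" and \<mu>: "\<mu> \<in> W1_space"
  shows "integrable \<mu> (\<lambda>y. H (x - y))"
proof -
  interpret prob_space \<mu> using \<mu> by (simp add: W1_space_def)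
  have [measurable_cong]: "sets \<mu> = sets borel" and int: "integrable \<mu> norm"
    using \<mu> by (auto simp: W1_space_def)
  have [measurable]: "H \<in> borel_measurable borel"
    using lipschitz_on_continuous_on[OF H] by (rule borel_measurable_continuous_onI)
  have L: "L \<ge> 0" using H by (rule lipschitz_on_nonneg)
  show ?thesis
  proof (rule Bochner_Integration.integrable_bound)
    show "integrable \<mu> (\<lambda>y. norm (H x) + L * norm y)" using int by simp
    have "norm (H (x - y)) \<le> norm (H x) + L * norm y" for y
      using lipschitz_on_UNIV_norm[OF H, of "x - y" x] norm_triangle_sub[of "H (x - y)" "H x"] by simp
    then show "AE y in \<mu>. norm (H (x - y)) \<le> norm (norm (H x) + L * norm y)"
      using L by simp
  qed measurable
qed

lemma mconv_lipschitz:
  fixes H :: "'v::euclidean_space \<Rightarrow> 'v"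
  assumes H: "L-lipschitz_on UNIV H" and \<mu>: "\<mu> \<in> W1_space"
  shows "norm (mconv H \<mu> x - mconv H \<mu> y) \<le> L * norm (x - y)"
proof -
  interpret prob_space \<mu> using \<mu> by (simp add: W1_space_def)
  note int = W1_space_integrable_lipschitz[OF H \<mu>]
  have "norm (mconv H \<mu> x - mconv H \<mu> y) = norm (\<integral>z. H (x - z) - H (y - z) \<partial>\<mu>)"
    using int by (simp add: mconv_def)
  also have "\<dots> \<le> (\<integral>z. norm (H (x - z) - H (y - z)) \<partial>\<mu>)" by (rule integral_norm_bound)
  also have "\<dots> \<le> L * norm (x - y)"
  proof (intro integral_le_const integrable_norm Bochner_Integration.integrable_diff int AE_I2)
    show "norm (H (x - z) - H (y - z)) \<le> L * norm (x - y)" for z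
      using lipschitz_on_UNIV_norm[OF H, of "x - z" "y - z"] by simp
  qed
  finally show ?thesis .
qed

lemma X_drift_lipschitz:
  fixes H1 K1 :: "real ^ 'd \<Rightarrow> real ^ 'd" and y :: "'m::finite \<Rightarrow> real ^ 'd"
  assumes H1: "L1-lipschitz_on UNIV H1" and K1: "L2-lipschitz_on UNIV K1" and \<mu>: "\<mu> \<in> W1_space"
  shows "norm (X_drift H1 K1 \<mu> y x - X_drift H1 K1 \<mu> y x') \<le> (L1 + L2) * norm (x - x')"
proof -
  have "norm (K1 (y j - x) - K1 (y j - x')) \<le> L2 * norm (x - x')" for j
    using lipschitz_on_UNIV_norm[OF K1, of "y j - x" "y j - x'"] by (simp add: norm_minus_commute)
  then have "norm (\<Sum>j\<in>UNIV. K1 (y j - x) - K1 (y j - x')) \<le> (\<Sum>j\<in>(UNIV :: 'm set). L2 * norm (x - x'))"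
    by (intro sum_norm_le)
  then have "norm ((1 / real CARD('m)) *\<^sub>R (\<Sum>j\<in>UNIV. K1 (y j - x) - K1 (y j - x'))) \<le> L2 * norm (x - x')"
    by (simp add: field_simps)
  moreover have "X_drift H1 K1 \<mu> y x - X_drift H1 K1 \<mu> y x' = (mconv H1 \<mu> x - mconv H1 \<mu> x')
      + (1 / real CARD('m)) *\<^sub>R (\<Sum>j\<in>UNIV. K1 (y j - x) - K1 (y j - x'))"
    by (simp add: X_drift_def sum_subtractf scaleR_diff_right)
  ultimately show ?thesis
    using mconv_lipschitz[OF H1 \<mu>, of x x']
    by (simp add: distrib_right norm_triangle_mono)
qed

text \<open>The equations are stated with \<open>lebesgue\<close>, while Fubini and the cell
  integrals work with \<open>lborel\<close>; for Borel functions the completion changes neither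
  integrability nor the integral.\<close>

lemma set_integral_lebesgue:
  fixes f :: "'a::euclidean_space \<Rightarrow> 'b::{banach, second_countable_topology}"
  assumes "set_integrable lborel A f"
  shows "set_integrable lebesgue A f" "(LINT x:A|lebesgue. f x) = (LINT x:A|lborel. f x)"
  using assms borel_measurable_integrable[of lborel "\<lambda>x. indicator A x *\<^sub>R f x"]
  by (simp_all add: set_integrable_def set_lebesgue_integral_def integrable_completion integral_completion)

lemma set_integrable_lborel_lebesgue:
  fixes f :: "'a::euclidean_space \<Rightarrow> 'b::{banach, second_countable_topology}"
  assumes "set_integrable lebesgue A f" "f \<in> borel_measurable borel" "A \<in> sets borel"
  shows "set_integrable lborel A f"
  using assms by (simp add: set_integrable_def integrable_completion)

theorem proposition3p5:
  fixes M :: "'a measure" and F :: "real \<Rightarrow> 'a measure"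
    and W :: "real \<Rightarrow> 'a \<Rightarrow> real ^ 'd"
    and T \<sigma> :: real
    and H1 H2 K1 K2 :: "real ^ 'd \<Rightarrow> real ^ 'd"
    and u :: "'m::finite \<Rightarrow> real \<Rightarrow> (real ^ 'd) measure \<Rightarrow> real ^ 'd"
    and X0 :: "'a \<Rightarrow> real ^ 'd" and Y0 :: "'m \<Rightarrow> real ^ 'd"
    and X :: "'a \<Rightarrow> real \<Rightarrow> real ^ 'd" and Y :: "'m \<Rightarrow> real \<Rightarrow> real ^ 'd"
  assumes "T > 0" and "\<sigma> > 0"
    and "brownian_motion M F T W"
    and "\<exists>L. L-lipschitz_on UNIV H1" and "\<exists>L. L-lipschitz_on UNIV H2"
    and "\<exists>L. L-lipschitz_on UNIV K1" and "\<exists>L. L-lipschitz_on UNIV K2"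
    and "\<And>i. caratheodory_control T (u i)"
    and "\<And>i. integrably_lipschitz_control T (u i)"
    and "X0 \<in> borel_measurable (F 0)"
    and "\<exists>p>1. integrable M (\<lambda>\<omega>. norm (X0 \<omega>) powr p)"
    and "pathwise_solution M W T \<sigma> H1 H2 K1 K2 u X0 Y0 X Y"
  shows "PDE_ODE_solution T \<sigma> H1 H2 K1 K2 u
           (distr M borel X0) Y0 (\<lambda>t. distr M borel (\<lambda>\<omega>. X \<omega> t)) Y"
proof -
  interpret brownian_motion M F T W by fact
  define \<mu> where "\<mu> t = distr M borel (\<lambda>\<omega>. X \<omega> t)" for t
  define c where "c = sqrt (2 * \<sigma>)"
  have c: "c \<ge> 0" "c\<^sup>2 / 2 = \<sigma>" using \<open>\<sigma> > 0\<close> by (auto simp: c_def)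
  have X: "X \<in> measurable M (path_space T)"
    using assms(12) by (simp add: pathwise_solution_def Let_def)
  have ev: "ev_law (path_law M T X) = \<mu>"
    unfolding \<mu>_def by (rule ev_law_path_law[OF X])
  have \<mu>W1: "\<mu> t \<in> W1_space" if "t \<in> {0..T}" for t
    using assms(12) that by (simp add: pathwise_solution_def Let_def ev)
  have Xsol: "AE \<omega> in M. X \<omega> 0 = X0 \<omega> \<and>
           set_integrable lebesgue {0..T} (\<lambda>s. X_drift H1 K1 (\<mu> s) (\<lambda>j. Y j s) (X \<omega> s)) \<and>
           (\<forall>t\<in>{0..T}. X \<omega> t = X \<omega> 0
              + (LINT s:{0..t}|lebesgue. X_drift H1 K1 (\<mu> s) (\<lambda>j. Y j s) (X \<omega> s))
              + c *\<^sub>R W t \<omega>)"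
    and Ysol: "caratheodory_solution T (\<lambda>s. Y_drift K2 H2 u s (\<mu> s)) Y0 Y"
    using assms(12) by (simp_all add: pathwise_solution_def Let_def ev c_def)
  obtain L1 L2 where H1: "L1-lipschitz_on UNIV H1" and K1: "L2-lipschitz_on UNIV K1"
    using assms(4,6) by blast
  have Xm [measurable]: "(\<lambda>\<omega>. X \<omega> t) \<in> borel_measurable M" for t
    by (rule measurable_compose[OF X path_space_eval_measurable])
  have X0m [measurable]: "X0 \<in> borel_measurable M"
    using \<open>T > 0\<close> by (intro filtration_measurable[OF assms(10)]) auto

  \<comment> \<open>Clamping time to \<open>[0,T]\<close> turns \<open>X\<close>, \<open>Y\<close> and the drift into jointly Borel functions on all of \<open>\<real>\<close>.\<close>
  define cl where "cl s = max 0 (min T s)" for s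
  have cl: "cl s \<in> {0..T}" "s \<in> {0..T} \<Longrightarrow> cl s = s" for s
    using \<open>T > 0\<close> by (auto simp: cl_def)
  have cl_cont: "continuous_on UNIV cl" unfolding cl_def by (intro continuous_intros)
  define Z where "Z s \<omega> = X \<omega> (cl s)" for s \<omega>
  have Zcont: "continuous_on UNIV (\<lambda>s. Z s \<omega>)" if "\<omega> \<in> space M" for \<omega>
    unfolding Z_def using measurable_space[OF X that] cl
    by (intro continuous_on_compose2[OF path_spaceD(1) cl_cont]) auto
  have Z_path: "(\<lambda>s. Z s \<omega>) \<in> borel_measurable borel" if "\<omega> \<in> space M" for \<omega>
    by (rule borel_measurable_continuous_onI[OF Zcont[OF that]])
  have Zpair: "(\<lambda>(s, \<omega>). Z s \<omega>) \<in> borel_measurable (borel \<Otimes>\<^sub>M M)"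
    by (rule borel_measurable_pair_continuous[OF _ Zcont]) (simp_all add: Z_def)
  define b where "b s x = X_drift H1 K1 (\<mu> (cl s)) (\<lambda>j. Y j (cl s)) x" for s x
  define L where "L = L1 + L2"
  have L: "L \<ge> 0" using lipschitz_on_nonneg[OF H1] lipschitz_on_nonneg[OF K1] by (simp add: L_def)
  have b_lip: "norm (b s x - b s y) \<le> L * norm (x - y)" for s x y
    unfolding b_def L_def by (intro X_drift_lipschitz H1 K1 \<mu>W1 cl)
  have b_eq: "b s x = X_drift H1 K1 (\<mu> s) (\<lambda>j. Y j s) x" if "s \<in> {0..T}" for s x
    using that by (simp add: b_def cl)
  have b_pair: "(\<lambda>(s, x). b s x) \<in> borel_measurable (borel \<Otimes>\<^sub>M borel)"
  proof -
    have [measurable]: "H1 \<in> borel_measurable borel" "K1 \<in> borel_measurable borel"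
      using lipschitz_on_continuous_on[OF H1] lipschitz_on_continuous_on[OF K1]
      by (auto intro: borel_measurable_continuous_onI)
    have [measurable]: "(\<lambda>s. Y j (cl s)) \<in> borel_measurable borel" for j
    proof -
      have "continuous_on {0..T} (Y j)" using Ysol by (simp add: caratheodory_solution_def)
      then have "continuous_on UNIV (\<lambda>s. Y j (cl s))"
        by (rule continuous_on_compose2[OF _ cl_cont]) (use cl in auto)
      then show ?thesis by (rule borel_measurable_continuous_onI)
    qed
    have [measurable]: "(\<lambda>q. Z (fst (fst q)) (snd q)) \<in> borel_measurable ((borel \<Otimes>\<^sub>M (borel :: (real ^ 'd) measure)) \<Otimes>\<^sub>M M)"
    proof -
      have "(\<lambda>q. (fst (fst q), snd q)) \<in> (borel \<Otimes>\<^sub>M (borel :: (real ^ 'd) measure)) \<Otimes>\<^sub>M M \<rightarrow>\<^sub>M borel \<Otimes>\<^sub>M M"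
        by measurable
      from measurable_compose[OF this Zpair] show ?thesis by simp
    qed
    \<comment> \<open>Writing the convolution as an integral over \<open>M\<close> reduces its joint
      measurability in time and state to that of \<open>Z\<close>, so the curve of measures never
      has to be treated as a measurable object.\<close>
    have "(\<lambda>p. \<integral>\<omega>. H1 (snd p - Z (fst p) \<omega>) \<partial>M) \<in> borel_measurable (borel \<Otimes>\<^sub>M borel)"
      by (intro borel_measurable_lebesgue_integral) (simp add: case_prod_beta')
    moreover have "mconv H1 (\<mu> (cl s)) x = (\<integral>\<omega>. H1 (x - Z s \<omega>) \<partial>M)" for s x
      unfolding mconv_def \<mu>_def Z_def by (subst integral_distr) auto
    ultimately have [measurable]: "(\<lambda>p. mconv H1 (\<mu> (cl (fst p))) (snd p)) \<in> borel_measurable (borel \<Otimes>\<^sub>M borel)"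
      by simp
    show ?thesis unfolding b_def X_drift_def case_prod_beta' by measurable
  qed
  have b_comp [measurable]: "(\<lambda>s. b s (f s)) \<in> borel_measurable borel" if "f \<in> borel_measurable borel" for f
    using measurable_compose[OF measurable_Pair[OF measurable_ident that] b_pair] by simp
  \<comment> \<open>Time integrability of the drift at a fixed point is no hypothesis; it is read off from a single
    path, along which the drift is integrable and which stays in a bounded set.\<close>
  have b_int: "set_integrable lborel {0..T} (\<lambda>s. b s 0)"
  proof -
    \<comment> \<open>An almost sure property of a probability space holds for at least one
      \<open>\<omega>\<close>.\<close>
    have "\<exists>\<omega>\<in>space M. set_integrable lebesgue {0..T} (\<lambda>s. X_drift H1 K1 (\<mu> s) (\<lambda>j. Y j s) (X \<omega> s))"
    proof (rule ccontr)
      assume "\<not> ?thesis"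
      with Xsol have "AE \<omega> in M. False" by (auto elim: eventually_mono)
      then show False by simp
    qed
    then obtain \<omega> where \<omega>: "\<omega> \<in> space M"
      and "set_integrable lebesgue {0..T} (\<lambda>s. X_drift H1 K1 (\<mu> s) (\<lambda>j. Y j s) (X \<omega> s))" by blast
    then have "set_integrable lebesgue {0..T} (\<lambda>s. b s (Z s \<omega>))"
      by (subst set_integrable_cong[OF refl refl]) (auto simp: b_eq Z_def cl)
    then have 1: "set_integrable lborel {0..T} (\<lambda>s. b s (Z s \<omega>))"
      by (rule set_integrable_lborel_lebesgue[OF _ b_comp[OF Z_path[OF \<omega>]]]) simp
    have "compact ((\<lambda>s. Z s \<omega>) ` {0..T})"
      by (intro compact_continuous_image continuous_on_subset[OF Zcont[OF \<omega>]]) auto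
    then obtain K where K: "\<And>s. s \<in> {0..T} \<Longrightarrow> norm (Z s \<omega>) \<le> K"
      by (force simp: bounded_pos dest!: compact_imp_bounded)
    show ?thesis
    proof (rule set_integrable_bound)
      show "set_integrable lborel {0..T} (\<lambda>s. norm (b s (Z s \<omega>)) + L * K)"
        using 1 by (intro set_integral_add set_integrable_norm set_integrable_lborel_const[of _ 0 T]) auto
      show "set_borel_measurable lborel {0..T} (\<lambda>s. b s 0)"
        unfolding set_borel_measurable_def by measurable
      have "norm (b s 0) \<le> norm (b s (Z s \<omega>)) + L * K" if "s \<in> {0..T}" for s
      proof -
        have "norm (b s 0) \<le> norm (b s (Z s \<omega>)) + norm (b s 0 - b s (Z s \<omega>))"
          by (rule norm_triangle_sub)
        also have "norm (b s 0 - b s (Z s \<omega>)) \<le> L * norm (Z s \<omega>)" using b_lip[of s 0 "Z s \<omega>"] by simp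
        also have "L * norm (Z s \<omega>) \<le> L * K" using K[OF that] L by (rule mult_left_mono)
        finally show ?thesis by simp
      qed
      then show "AE s in lborel. s \<in> {0..T} \<longrightarrow> norm (b s 0) \<le> norm (norm (b s (Z s \<omega>)) + L * K)"
        by (auto intro: order_trans[OF _ abs_ge_self])
    qed
  qed
  interpret euler_scheme M F T W b L X0 c
    by unfold_locales (use assms(1,10) L b_pair b_lip b_int c in auto)
  have sol: "AE \<omega> in M. Z 0 \<omega> = X0 \<omega> \<and> integral_solution c (\<lambda>t. W t \<omega>) (\<lambda>s. Z s \<omega>)"
    using Xsol AE_space
  proof eventually_elim
    case (elim \<omega>)
    have "Z r \<omega> = Z 0 \<omega> + (LINT s:{0..<r}|lborel. b s (Z s \<omega>)) + c *\<^sub>R W r \<omega>" if r: "r \<in> {0..T}" for r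
    proof -
      \<comment> \<open>Clamping changes nothing on \<open>[0,r]\<close>; removing the completion
        and then the right endpoint leads to the form used in
        \<open>integral_solution\<close>.\<close>
      have "(LINT s:{0..r}|lebesgue. X_drift H1 K1 (\<mu> s) (\<lambda>j. Y j s) (X \<omega> s)) = (LINT s:{0..r}|lebesgue. b s (Z s \<omega>))"
        using r by (intro set_lebesgue_integral_cong) (auto simp: b_eq Z_def cl)
      also have "\<dots> = (LINT s:{0..r}|lborel. b s (Z s \<omega>))"
        unfolding set_lebesgue_integral_def
        using b_comp[OF Z_path[OF elim(2)]] by (intro integral_completion) auto
      also have "\<dots> = (LINT s:{0..<r}|lborel. b s (Z s \<omega>))" by (rule set_integral_Icc_Ico)
      finally show ?thesis using elim(1) r \<open>T > 0\<close> by (simp add: Z_def cl)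
    qed
    then show ?case
      using elim Zcont \<open>T > 0\<close> by (auto simp: integral_solution_def Z_def cl)
  qed
  have weak: "weak_solution T \<sigma> (\<lambda>s. X_drift H1 K1 (\<mu> s) (\<lambda>j. Y j s)) \<mu>"
    unfolding weak_solution_def
  proof (intro ballI conjI)
    fix \<phi> :: "real ^ 'd \<Rightarrow> real" assume \<phi>: "\<phi> \<in> test_functions"
    note [measurable] = test_function_measurable[OF \<phi>]
    have generator_eq: "gradient \<phi> x \<bullet> X_drift H1 K1 (\<mu> s) (\<lambda>j. Y j s) x + \<sigma> * laplacian \<phi> x = generator c \<phi> s x"
      if "s \<in> {0..T}" for s x
      using that by (simp add: generator_def c b_eq)
    have [measurable]: "generator c \<phi> s \<in> borel_measurable borel" for s
      using generator_measurable[OF \<phi>, of "\<lambda>_. s" borel "\<lambda>x. x"] by simp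
    obtain C where C: "C \<ge> 0" "\<And>s x. \<bar>generator c \<phi> s x\<bar> \<le> C * (norm (b s 0) + 1)"
      using generator_bound[OF \<phi>] by blast
    show "integrable (\<mu> s) (\<lambda>x. gradient \<phi> x \<bullet> X_drift H1 K1 (\<mu> s) (\<lambda>j. Y j s) x + \<sigma> * laplacian \<phi> x)"
      if s: "s \<in> {0..T}" for s
    proof -
      have "integrable M (\<lambda>\<omega>. generator c \<phi> s (X \<omega> s))"
        by (rule integrable_const_bound[of _ "C * (norm (b s 0) + 1)"]) (use C in auto)
      then show ?thesis unfolding generator_eq[OF s] unfolding \<mu>_def by (simp add: integrable_distr_eq)
    qed
    have E_eq: "(\<integral>x. gradient \<phi> x \<bullet> X_drift H1 K1 (\<mu> s) (\<lambda>j. Y j s) x + \<sigma> * laplacian \<phi> x \<partial>\<mu> s)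
       = expectation (\<lambda>\<omega>. generator c \<phi> s (Z s \<omega>))" if s: "s \<in> {0..T}" for s
      unfolding generator_eq[OF s] unfolding \<mu>_def Z_def cl(2)[OF s] by (rule integral_distr) auto
    note wi = expectation_weak_identity[OF Zpair sol \<phi>]
    \<comment> \<open>The weak equation uses closed time intervals; the endpoint added here is a
      null set.\<close>
    have int: "set_integrable lborel {0..t} (\<lambda>s. expectation (\<lambda>\<omega>. generator c \<phi> s (Z s \<omega>)))"
      if t: "t \<in> {0..T}" for t
      using wi(1)[of t] t by (subst set_integrable_discrete_difference[where X="{t}" and B="{0..<t}"]) auto
    show "set_integrable lebesgue {0..T} (\<lambda>s. \<integral>x. gradient \<phi> x \<bullet> X_drift H1 K1 (\<mu> s) (\<lambda>j. Y j s) x + \<sigma> * laplacian \<phi> x \<partial>\<mu> s)"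
      using set_integral_lebesgue(1)[OF int[of T]] \<open>T > 0\<close>
      by (subst set_integrable_cong[OF refl refl E_eq]) auto
    show "(\<integral>x. \<phi> x \<partial>\<mu> t) = (\<integral>x. \<phi> x \<partial>\<mu> 0) +
           (LINT s:{0..t}|lebesgue. \<integral>x. gradient \<phi> x \<bullet> X_drift H1 K1 (\<mu> s) (\<lambda>j. Y j s) x + \<sigma> * laplacian \<phi> x \<partial>\<mu> s)"
      if t: "t \<in> {0..T}" for t
    proof -
      have E\<phi>: "(\<integral>x. \<phi> x \<partial>\<mu> s) = expectation (\<lambda>\<omega>. \<phi> (Z s \<omega>))" if "s \<in> {0..T}" for s
        unfolding \<mu>_def Z_def cl(2)[OF that] by (rule integral_distr) auto
      have "(LINT s:{0..t}|lebesgue. \<integral>x. gradient \<phi> x \<bullet> X_drift H1 K1 (\<mu> s) (\<lambda>j. Y j s) x + \<sigma> * laplacian \<phi> x \<partial>\<mu> s)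
        = (LINT s:{0..t}|lebesgue. expectation (\<lambda>\<omega>. generator c \<phi> s (Z s \<omega>)))"
        using t E_eq by (intro set_lebesgue_integral_cong) auto
      also have "\<dots> = (LINT s:{0..<t}|lborel. expectation (\<lambda>\<omega>. generator c \<phi> s (Z s \<omega>)))"
        by (simp add: set_integral_lebesgue(2)[OF int[OF t]] set_integral_Icc_Ico)
      finally show ?thesis using wi(2)[of t] t \<open>T > 0\<close> by (simp add: E\<phi>)
    qed
  qed
  have "\<mu> 0 = distr M borel X0"
    unfolding \<mu>_def using Xsol by (intro distr_cong_AE) auto
  with \<mu>W1 weak Ysol show ?thesis
    unfolding PDE_ODE_solution_def \<mu>_def[symmetric] by simp
qed

end
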